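(* Let $V^-,V^+:\mathbb{N}^d\to\mathbb{R}$ be given and let $\mathcal{L}$ be the generator on $\mathbb{N}^d$ with moves $\gamma_i^{\pm}$ and rates $$c(\eta,\gamma_i^+)=\exp(-\nabla_i^+V^+(\eta)),\qquad c(\eta,\gamma_i^-)=\exp(-\nabla_i^-V^-(\eta))\,\mathbf 1_{\{\eta_i>0\}}.$$ Assume that $\kappa^+(\eta,i)\ge 0$ and $\kappa^-(\eta,i)\ge 0$ for all $\eta\in\mathbb{N}^d$, $1\le i\le d$, where $$\kappa^+(\eta,i)=-\nabla_i^+c(\eta,\gamma_i^+)-\sum_{\gamma\in G\setminus\{\gamma_i^+,\gamma_i^-\}}\max\{\nabla_i^+c(\eta,\gamma),0\},$$ $$\kappa^-(\eta,i)=\nabla_i^+c(\eta,\gamma_i^-)-\sum_{\gamma\in G\setminus\{\gamma_i^+,\gamma_i^-\}}\max\{-\nabla_i^+c(\eta,\gamma),0\}.$$ Then properties (Irr) and (Rev) hold with $\mathbf m=\frac1Z\exp(-V^+-V^-)$, where $Z$ is the normalization constant. If we define $$\kappa=\inf_{\eta\in\mathbb{N}^d,\,1\le i\le d}\big(\kappa^+(\eta,i)+\kappa^-(\eta,i)\big),$$ then the following holds: (i) For every admissible $\phi$ the convex Sobolev inequality holds with constant $\kappa_\phi=\kappa$. In particular the modified logarithmic Sobolev inequality holds with $\kappa_1=\kappa$. (ii) For every $\alpha\in(1,2]$ the Beckner inequality holds with constant $\kappa_\alpha=\alpha\kappa$.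
   Context: Setting: $d\ge1$, $\mathbb{N}=\{0,1,2,\dots\}$, $\Omega=\mathbb{N}^d$ with canonical basis $(\mathbf e_i)_{i\le d}$. The set of moves is $G=\{\gamma_i^+,\gamma_i^-:1\le i\le d\}$, with $\gamma_i^+\eta=\eta+\mathbf e_i$ and $\gamma_i^-\eta=\eta-\mathbf e_i\mathbf 1_{\{\eta_i>0\}}$. For a function $F$ on $\mathbb{N}^d$, $\nabla_i^{\pm}F(\eta)=F(\gamma_i^{\pm}\eta)-F(\eta)$; $\nabla_i^+c(\eta,\gamma)=c(\gamma_i^+\eta,\gamma)-c(\eta,\gamma)$ for $\gamma\in G$. Given rates $c:\Omega\times G\to[0,\infty)$, $\mathcal{L}f(\eta)=\sum_{i=1}^d \big[c(\eta,\gamma_i^+)\nabla_i^+f(\eta)+c(\eta,\gamma_i^-)\nabla_i^-f(\eta)\big]$. (Irr): $G$ is finite, $\mathcal L$ is irreducible and admits an invariant probability measure $\mathbf m$ with $\sum_{\eta\in\Omega,\sigma\in G}c(\eta,\sigma)\mathbf m(\eta)<\infty$. (Rev): there is an involution $\sigma\mapsto\sigma^{-1}$ of $G$ (here $(\gamma_i^{\pm})^{-1}=\gamma_i^{\mp}$) such that $\sigma^{-1}(\sigma\eta)=\eta$ whenever $\mathbf m(\eta)c(\eta,\sigma)>0$, and $\sum_{\eta,\sigma}F(\eta,\sigma)c(\eta,\sigma)\mathbf m(\eta)=\sum_{\eta,\sigma}F(\sigma\eta,\sigma^{-1})c(\eta,\sigma)\mathbf m(\eta)$ for all bounded $F:\Omega\times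 G\to\mathbb R$. Admissible functions: $\phi:[0,\infty)\to[0,\infty)$ is admissible if it is convex, differentiable on $(0,\infty)$, and $\Phi(a,b):=(\phi'(b)-\phi'(a))(b-a)$ is convex on $(0,\infty)^2$. For $f:\Omega\to(0,\infty)$ with $\sum_\eta f(\eta)\mathbf m(\eta)<\infty$, $\mathcal H^\phi(f|\mathbf m)=\sum_\eta\phi(f(\eta))\mathbf m(\eta)-\phi\big(\sum_\eta f(\eta)\mathbf m(\eta)\big)$. The convex Sobolev inequality with constant $\kappa_\phi$ is: for all such $f$, $$\kappa_\phi\,\mathcal H^\phi(f|\mathbf m)\le\frac12\sum_{\eta\in\Omega,\sigma\in G}c(\eta,\sigma)\,\Phi(f(\eta),f(\sigma\eta))\,\mathbf m(\eta).$$ Let $\phi_1(a)=a\log a-a+1$ and $\phi_\alpha(a)=\frac{1}{\alpha-1}(a^\alpha-a)-a+1$ for $\alpha\in(1,2]$. The modified logarithmic Sobolev inequality with constant $\kappa_1$ is the convex Sobolev inequality for $\phi=\phi_1$; the Beckner inequality with constant $\kappa_\alpha$ is the one for $\phi=\phi_\alpha$.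
   Formalization: It is additionally assumed that Z is finite or κ > 0 (when κ > 0, finiteness of Z is proved); otherwise the claim fails, e.g. for d = 1 with constant birth rate at least the constant death rate, where κ = 0 and Z is infinite. *)

theory Defs
  imports "HOL-Analysis.Analysis"
begin

datatype 'd move = Up 'd | Down 'd

lemma UNIV_move: "(UNIV :: 'd move set) = range Up \<union> range Down"
  by (metis (no_types) UNIV_eq_I UnCI move.exhaust rangeI)

instance move :: (finite) finite
  by standard (simp add: UNIV_move)

primrec act :: "'d::finite move \<Rightarrow> nat ^ 'd \<Rightarrow> nat ^ 'd" where
  "act (Up i) \<eta> = \<eta> + axis i 1"
| "act (Down i) \<eta> = (if \<eta> $ i > 0 then \<eta> - axis i 1 else \<eta>)"

primrec inv_move :: "'d move \<Rightarrow> 'd move" where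
  "inv_move (Up i) = Down i"
| "inv_move (Down i) = Up i"

definition nabla :: "'d::finite move \<Rightarrow> (nat ^ 'd \<Rightarrow> real) \<Rightarrow> nat ^ 'd \<Rightarrow> real" where
  "nabla \<sigma> F \<eta> = F (act \<sigma> \<eta>) - F \<eta>"

definition generator ::
  "(nat ^ 'd \<Rightarrow> 'd::finite move \<Rightarrow> real) \<Rightarrow> (nat ^ 'd \<Rightarrow> real) \<Rightarrow> nat ^ 'd \<Rightarrow> real" where
  "generator c f \<eta> =
     (\<Sum>i\<in>UNIV. c \<eta> (Up i) * nabla (Up i) f \<eta> + c \<eta> (Down i) * nabla (Down i) f \<eta>)"

definition irreducible_rates :: "(nat ^ 'd \<Rightarrow> 'd::finite move \<Rightarrow> real) \<Rightarrow> bool" where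
  "irreducible_rates c \<longleftrightarrow> (\<forall>\<eta> \<xi>. (\<eta>, \<xi>) \<in> {(\<zeta>, act \<sigma> \<zeta>) | \<zeta> \<sigma>. c \<zeta> \<sigma> > 0}\<^sup>*)"

text \<open>Measures on the configuration space are given by their mass functions.\<close>

definition prob_mass :: "('a \<Rightarrow> real) \<Rightarrow> bool" where
  "prob_mass m \<longleftrightarrow> (\<forall>\<eta>. m \<eta> \<ge> 0) \<and> (m has_sum 1) UNIV"

definition invariant_for ::
  "(nat ^ 'd \<Rightarrow> 'd::finite move \<Rightarrow> real) \<Rightarrow> (nat ^ 'd \<Rightarrow> real) \<Rightarrow> bool" where
  "invariant_for c m \<longleftrightarrow>
     (\<forall>f. bounded (range f) \<longrightarrow> ((\<lambda>\<eta>. generator c f \<eta> * m \<eta>) has_sum 0) UNIV)"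

definition Irr ::
  "(nat ^ 'd \<Rightarrow> 'd::finite move \<Rightarrow> real) \<Rightarrow> (nat ^ 'd \<Rightarrow> real) \<Rightarrow> bool" where
  "Irr c m \<longleftrightarrow> finite (UNIV :: 'd move set) \<and> irreducible_rates c \<and>
     prob_mass m \<and> invariant_for c m \<and>
     (\<lambda>(\<eta>, \<sigma>). c \<eta> \<sigma> * m \<eta>) summable_on UNIV"

text \<open>The sums in the last clause converge absolutely as soon as \<open>Irr c m\<close> holds,
  because the test functions are bounded.\<close>

definition Rev ::
  "(nat ^ 'd \<Rightarrow> 'd::finite move \<Rightarrow> real) \<Rightarrow> (nat ^ 'd \<Rightarrow> real) \<Rightarrow> bool" where
  "Rev c m \<longleftrightarrow>
     (\<forall>\<sigma> :: 'd move. inv_move (inv_move \<sigma>) = \<sigma>) \<and>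
     (\<forall>\<eta> \<sigma>. m \<eta> * c \<eta> \<sigma> > 0 \<longrightarrow> act (inv_move \<sigma>) (act \<sigma> \<eta>) = \<eta>) \<and>
     (\<forall>F :: nat ^ 'd \<Rightarrow> 'd move \<Rightarrow> real. bounded (range (\<lambda>(\<eta>, \<sigma>). F \<eta> \<sigma>)) \<longrightarrow>
        (\<Sum>\<^sub>\<infinity>(\<eta>, \<sigma>)\<in>UNIV. F \<eta> \<sigma> * c \<eta> \<sigma> * m \<eta>) =
        (\<Sum>\<^sub>\<infinity>(\<eta>, \<sigma>)\<in>UNIV. F (act \<sigma> \<eta>) (inv_move \<sigma>) * c \<eta> \<sigma> * m \<eta>))"

definition Phi :: "(real \<Rightarrow> real) \<Rightarrow> real \<Rightarrow> real \<Rightarrow> real" where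
  "Phi \<phi> a b = (deriv \<phi> b - deriv \<phi> a) * (b - a)"

text \<open>Only the values of \<open>\<phi>\<close> on the half-line \<open>{0..}\<close> matter here and below.\<close>

definition admissible :: "(real \<Rightarrow> real) \<Rightarrow> bool" where
  "admissible \<phi> \<longleftrightarrow>
     (\<forall>a\<ge>0. \<phi> a \<ge> 0) \<and> convex_on {0..} \<phi> \<and>
     (\<forall>a>0. \<phi> differentiable at a) \<and>
     convex_on ({0<..} \<times> {0<..}) (\<lambda>(a, b). Phi \<phi> a b)"

text \<open>The entropy and the right-hand side of the inequality are sums of nonnegative
  terms that may diverge, hence they take values in \<open>ereal\<close>.\<close>

definition entropy_phi :: "(real \<Rightarrow> real) \<Rightarrow> ('a \<Rightarrow> real) \<Rightarrow> ('a \<Rightarrow> real) \<Rightarrow> ereal" where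
  "entropy_phi \<phi> m f =
     (\<Sum>\<^sub>\<infinity>\<eta>\<in>UNIV. ereal (\<phi> (f \<eta>) * m \<eta>)) - ereal (\<phi> (\<Sum>\<^sub>\<infinity>\<eta>\<in>UNIV. f \<eta> * m \<eta>))"

definition convex_sobolev ::
  "(nat ^ 'd \<Rightarrow> 'd::finite move \<Rightarrow> real) \<Rightarrow> (nat ^ 'd \<Rightarrow> real) \<Rightarrow>
   (real \<Rightarrow> real) \<Rightarrow> real \<Rightarrow> bool" where
  "convex_sobolev c m \<phi> \<kappa> \<longleftrightarrow>
     (\<forall>f. (\<forall>\<eta>. f \<eta> > 0) \<and> (\<lambda>\<eta>. f \<eta> * m \<eta>) summable_on UNIV \<longrightarrow>
        ereal \<kappa> * entropy_phi \<phi> m f \<le>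
        ereal (1 / 2) * (\<Sum>\<^sub>\<infinity>(\<eta>, \<sigma>)\<in>UNIV. ereal (c \<eta> \<sigma> * Phi \<phi> (f \<eta>) (f (act \<sigma> \<eta>)) * m \<eta>)))"

definition phi_1 :: "real \<Rightarrow> real" where
  "phi_1 a = a * ln a - a + 1"

definition phi_alpha :: "real \<Rightarrow> real \<Rightarrow> real" where
  "phi_alpha \<alpha> a = 1 / (\<alpha> - 1) * (a powr \<alpha> - a) - a + 1"

definition modified_log_sobolev ::
  "(nat ^ 'd \<Rightarrow> 'd::finite move \<Rightarrow> real) \<Rightarrow> (nat ^ 'd \<Rightarrow> real) \<Rightarrow> real \<Rightarrow> bool" where
  "modified_log_sobolev c m \<kappa> \<longleftrightarrow> convex_sobolev c m phi_1 \<kappa>"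

definition beckner ::
  "(nat ^ 'd \<Rightarrow> 'd::finite move \<Rightarrow> real) \<Rightarrow> (nat ^ 'd \<Rightarrow> real) \<Rightarrow> real \<Rightarrow> real \<Rightarrow> bool" where
  "beckner c m \<alpha> \<kappa> \<longleftrightarrow> convex_sobolev c m (phi_alpha \<alpha>) \<kappa>"

primrec rate ::
  "(nat ^ 'd \<Rightarrow> real) \<Rightarrow> (nat ^ 'd \<Rightarrow> real) \<Rightarrow> nat ^ 'd \<Rightarrow> 'd::finite move \<Rightarrow> real" where
  "rate Vp Vm \<eta> (Up i) = exp (- nabla (Up i) Vp \<eta>)"
| "rate Vp Vm \<eta> (Down i) = exp (- nabla (Down i) Vm \<eta>) * of_bool (\<eta> $ i > 0)"

text \<open>Nonnegativity of \<open>kappa_plus\<close> and \<open>kappa_minus\<close> alone does not make the weights summable: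
  for a single queue with constant birth rate at least the constant death rate, both are
  nonnegative, \<open>kappa\<close> is \<open>0\<close> and the normalization constant is infinite.\<close>

definition weight :: "('a \<Rightarrow> real) \<Rightarrow> ('a \<Rightarrow> real) \<Rightarrow> 'a \<Rightarrow> real" where
  "weight Vp Vm \<eta> = exp (- Vp \<eta> - Vm \<eta>)"

definition gibbs :: "('a \<Rightarrow> real) \<Rightarrow> ('a \<Rightarrow> real) \<Rightarrow> 'a \<Rightarrow> real" where
  "gibbs Vp Vm \<eta> = 1 / (\<Sum>\<^sub>\<infinity>\<xi>\<in>UNIV. weight Vp Vm \<xi>) * weight Vp Vm \<eta>"

definition kappa_plus ::
  "(nat ^ 'd \<Rightarrow> 'd::finite move \<Rightarrow> real) \<Rightarrow> nat ^ 'd \<Rightarrow> 'd \<Rightarrow> real" where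
  "kappa_plus c \<eta> i =
     - nabla (Up i) (\<lambda>\<zeta>. c \<zeta> (Up i)) \<eta>
     - (\<Sum>\<gamma>\<in>UNIV - {Up i, Down i}. max (nabla (Up i) (\<lambda>\<zeta>. c \<zeta> \<gamma>) \<eta>) 0)"

definition kappa_minus ::
  "(nat ^ 'd \<Rightarrow> 'd::finite move \<Rightarrow> real) \<Rightarrow> nat ^ 'd \<Rightarrow> 'd \<Rightarrow> real" where
  "kappa_minus c \<eta> i =
     nabla (Up i) (\<lambda>\<zeta>. c \<zeta> (Down i)) \<eta>
     - (\<Sum>\<gamma>\<in>UNIV - {Up i, Down i}. max (- nabla (Up i) (\<lambda>\<zeta>. c \<zeta> \<gamma>) \<eta>) 0)"

definition kappa :: "(nat ^ 'd \<Rightarrow> 'd::finite move \<Rightarrow> real) \<Rightarrow> real" where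
  "kappa c = (INF (\<eta>, i)\<in>UNIV. kappa_plus c \<eta> i + kappa_minus c \<eta> i)"

end

theory Submission
  imports Defs
begin

text \<open>
  The Bakry-Emery argument is carried out in discrete time. On a finite cube, with the exits
  suppressed, one step of the chain is \<open>P f = f + \<epsilon> L f\<close>. Couple the jumps from the two end
  points of each edge; by joint convexity of \<open>Phi \<phi>\<close>, the value of \<open>Phi \<phi>\<close> for \<open>P f\<close> along
  the edge is at most the average of its values for \<open>f\<close> along the edges reached by the coupling.
  Summed against the reversible weights the transport terms cancel around every lattice square,
  and only the loss due to merging, of rate at least \<open>\<kappa>\<close>, remains: the energy \<open>E\<close> satisfies
  \<open>E (P f) \<le> (1 - \<epsilon> \<kappa>) E f\<close>. The tangent inequality for \<open>\<phi>\<close> gives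
  \<open>H f - H (P f) \<le> \<epsilon> E f\<close> for the entropy \<open>H\<close>, and summing over the iterates of \<open>P\<close>, which
  converge to the mean, yields \<open>\<kappa> H f \<le> E f\<close>. Cubes are the right truncation because it only
  increases \<open>kappa_plus\<close> and \<open>kappa_minus\<close>. For the power functions, moving the two arguments of
  \<open>Phi \<phi>\<close> towards each other gains a factor \<open>\<alpha>\<close> to first order in \<open>\<epsilon>\<close>, whence the constant
  \<open>\<alpha> \<kappa>\<close>.
\<close>

section \<open>Moves on the lattice\<close>

text \<open>The obstacle is that nothing bounds the downward rates on the whole lattice: no
  \<epsilon> > 0 need make f + \<epsilon> L f positive for every positive f, and a continuous-time
  argument would have to justify differentiating the entropy along the semigroup. On a cube the
  rates are bounded, all sums are finite, and each step of the argument is an exact inequality that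
  uses only one derivative of \<phi>. \<open>kappa_plus\<close> and \<open>kappa_minus\<close> must
  be nonnegative separately because each of them is a jump rate of the coupling. The potentials
  enter through two identities only: detailed balance, and the equality of the rate products along
  the two upward paths around a lattice square. When \<kappa> = 0 the inequality is trivial; when
  \<kappa> > 0 the curvature also forces the weights to be summable.\<close>

lemma act_Up_nth: "act (Up i) \<eta> $ j = \<eta> $ j + of_bool (i = j)"
  by (simp add: axis_def)

text \<open>Truncated subtraction of naturals absorbs the case of an empty site, so both moves act
  on coordinates by formulas without a case distinction.\<close>

lemma act_Down_nth: "act (Down i) \<eta> $ j = \<eta> $ j - of_bool (i = j)"
  by (simp add: axis_def)

declare act.simps [simp del]

lemma act_Down_Up [simp]: "act (Down i) (act (Up i) \<eta>) = \<eta>"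
  by (simp add: vec_eq_iff act_Up_nth act_Down_nth)

lemma act_Up_Down [simp]: "\<eta> $ i > 0 \<Longrightarrow> act (Up i) (act (Down i) \<eta>) = \<eta>"
  by (auto simp: vec_eq_iff act_Up_nth act_Down_nth)

lemma act_Up_commute: "act (Up i) (act (Up j) \<eta>) = act (Up j) (act (Up i) \<eta>)"
  by (simp add: vec_eq_iff act_Up_nth)

lemma sum_nth_act_Up: "(\<Sum>j\<in>UNIV. act (Up i) \<eta> $ j) = Suc (\<Sum>j\<in>UNIV. \<eta> $ j)"
  by (simp add: act_Up_nth sum.distrib)

lemma lattice_induct [case_names zero Up]:
  fixes \<eta> :: "nat ^ 'd::finite"
  assumes "P 0" and "\<And>\<eta> i. P \<eta> \<Longrightarrow> P (act (Up i) \<eta>)"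
  shows "P \<eta>"
proof (induction "\<Sum>j\<in>UNIV. \<eta> $ j" arbitrary: \<eta>)
  case 0
  then have "\<eta> = 0" by (simp add: vec_eq_iff)
  then show ?case using assms by simp
next
  case (Suc n)
  then obtain i where "\<eta> $ i > 0"
    by (metis Zero_not_Suc bot_nat_0.not_eq_extremum sum.neutral)
  then have *: "act (Up i) (act (Down i) \<eta>) = \<eta>" by simp
  then have "n = (\<Sum>j\<in>UNIV. act (Down i) \<eta> $ j)"
    using Suc.hyps(2) sum_nth_act_Up[of i "act (Down i) \<eta>"] by simp
  then show ?case using Suc.hyps(1) assms(2) * by metis
qed

lemma sum_UNIV_move:
  fixes g :: "'d::finite move \<Rightarrow> 'a::comm_monoid_add"
  shows "(\<Sum>\<sigma>\<in>UNIV. g \<sigma>) = (\<Sum>i\<in>UNIV. g (Up i)) + (\<Sum>i\<in>UNIV. g (Down i))"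
proof -
  have "(\<Sum>\<sigma>\<in>UNIV. g \<sigma>) = sum g (range Up) + sum g (range Down)"
    unfolding UNIV_move by (rule sum.union_disjoint) auto
  then show ?thesis
    by (simp add: sum.reindex inj_on_def)
qed

lemma generator_eq_sum_moves: "generator c f \<eta> = (\<Sum>\<sigma>\<in>UNIV. c \<eta> \<sigma> * nabla \<sigma> f \<eta>)"
  by (simp add: generator_def sum_UNIV_move sum.distrib)

section \<open>Exhaustion of the lattice by finite cubes\<close>

definition cube :: "nat \<Rightarrow> (nat ^ 'd::finite) set" where
  "cube N = {\<eta>. \<forall>i. \<eta> $ i \<le> N}"

lemma finite_cube [simp]: "finite (cube N)"
proof -
  have "cube N \<subseteq> vec_lambda ` (PiE UNIV (\<lambda>_. {..N}))"
  proof
    fix \<eta> :: "nat ^ 'd" assume "\<eta> \<in> cube N"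
    then have "vec_nth \<eta> \<in> PiE UNIV (\<lambda>_. {..N})" by (auto simp: cube_def)
    then show "\<eta> \<in> vec_lambda ` (PiE UNIV (\<lambda>_. {..N}))"
      by (metis image_eqI vec_nth_inverse)
  qed
  then show ?thesis by (rule finite_subset) (intro finite_imageI finite_PiE; simp)
qed

lemma zero_in_cube [simp]: "0 \<in> cube N"
  by (simp add: cube_def)

lemma cube_nonempty [simp]: "cube N \<noteq> {}"
  using zero_in_cube by blast

lemma act_Up_in_cube: "act (Up i) \<eta> \<in> cube N \<longleftrightarrow> \<eta> \<in> cube N \<and> \<eta> $ i < N"
proof -
  have "act (Up i) \<eta> \<in> cube N \<longleftrightarrow> (\<forall>j. \<eta> $ j + of_bool (i = j) \<le> N)"
    by (simp add: cube_def act_Up_nth)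
  then show ?thesis
    unfolding cube_def by (auto simp: of_bool_def Suc_le_eq split: if_splits)
qed

lemma act_Down_in_cube: "\<eta> \<in> cube N \<Longrightarrow> act (Down i) \<eta> \<in> cube N"
  by (auto simp: cube_def act_Down_nth intro: le_trans[OF diff_le_self])

lemma cube_mono: "M \<le> N \<Longrightarrow> cube M \<subseteq> cube N"
  by (auto simp: cube_def intro: order_trans)

lemma finite_subset_cube:
  fixes F :: "(nat ^ 'd::finite) set"
  assumes "finite F"
  obtains M where "F \<subseteq> cube M"
proof -
  define A where "A = (\<lambda>(\<eta>::nat ^ 'd, i). \<eta> $ i) ` (F \<times> UNIV)"
  have "finite A" using assms by (simp add: A_def)
  then have "\<And>\<eta> i. \<eta> \<in> F \<Longrightarrow> \<eta> $ i \<le> Max A" by (intro Max_ge) (auto simp: A_def)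
  then have "F \<subseteq> cube (Max A)" by (auto simp: cube_def)
  then show ?thesis using that by blast
qed

text \<open>Cubes eventually contain every finite set, so unconditional sums over the lattice are
  limits along cubes.\<close>

lemma filterlim_cube: "filterlim cube (finite_subsets_at_top UNIV) sequentially"
proof -
  have "eventually (\<lambda>N. finite (cube N) \<and> F \<subseteq> cube N \<and> cube N \<subseteq> UNIV) sequentially"
    if F: "finite F" for F :: "(nat ^ 'd::finite) set"
  proof -
    obtain M where "F \<subseteq> cube M" using finite_subset_cube[OF F] .
    then have "F \<subseteq> cube N" if "N \<ge> M" for N using cube_mono[OF that] by blast
    then show ?thesis by (auto simp: eventually_sequentially)
  qed
  then show ?thesis unfolding filterlim_finite_subsets_at_top by blast
qed

lemma has_sum_imp_tendsto_cube: "(f has_sum s) UNIV \<Longrightarrow> (\<lambda>N. sum f (cube N)) \<longlonglongrightarrow> s"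
  unfolding has_sum_def by (rule filterlim_compose[OF _ filterlim_cube])

text \<open>An edge in direction i inside the cube is named either by its upper or by its lower end
  point. All summations by parts below rest on this exchange.\<close>

lemma sum_cube_shift:
  "(\<Sum>\<eta> | \<eta> \<in> cube N \<and> \<eta> $ i > 0. h \<eta>) = (\<Sum>\<eta> | \<eta> \<in> cube N \<and> \<eta> $ i < N. h (act (Up i) \<eta>))"
  by (rule sum.reindex_bij_witness[where i = "act (Up i)" and j = "act (Down i)"])
    (auto simp: act_Up_in_cube[symmetric] act_Down_in_cube, auto simp: act_Up_nth act_Up_in_cube)

section \<open>Jointly convex edge functions\<close>

lemma convex_combination_pos:
  fixes a b t :: real
  assumes "a > 0" "b > 0" "0 \<le> t" "t \<le> 1"
  shows "(1 - t) * a + t * b > 0"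
  using assms by (cases "t = 0") (auto intro!: add_nonneg_pos)

lemma convex_on_above_tangent_pos:
  assumes "convex_on {0<..} \<phi>" and "(\<phi> has_real_derivative D) (at a)" and "a > 0" "b > 0"
  shows "\<phi> b - \<phi> a \<ge> D * (b - a)"
  by (rule convex_on_imp_above_tangent[OF assms(1)])
    (use DERIV_subset[OF assms(2) subset_UNIV] assms(3,4) in \<open>auto simp: interior_open\<close>)

lemma powr_le_tangent:
  fixes p x y :: real
  assumes "0 \<le> p" "p \<le> 1" "x > 0" "y > 0"
  shows "x powr p \<le> y powr p + p * y powr (p - 1) * (x - y)"
proof -
  have "convex_on {0<..} (\<lambda>x. - (x powr p))"
  proof (rule f''_ge0_imp_convex)
    show "((\<lambda>x. - (x powr p)) has_real_derivative (- p * x powr (p - 1))) (at x)"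
      if "x \<in> {0<..}" for x
      using that by (auto intro!: derivative_eq_intros)
    show "((\<lambda>x. - p * x powr (p - 1)) has_real_derivative (- p * ((p - 1) * x powr (p - 2)))) (at x)"
      if "x \<in> {0<..}" for x
      using that by (auto intro!: derivative_eq_intros)
    show "- p * ((p - 1) * x powr (p - 2)) \<ge> 0" for x
      using assms by (simp add: mult_nonneg_nonpos mult_nonpos_nonneg)
  qed simp
  moreover have "((\<lambda>x. - (x powr p)) has_real_derivative - p * y powr (p - 1)) (at y)"
    using assms by (auto intro!: derivative_eq_intros)
  ultimately have "- (x powr p) - - (y powr p) \<ge> (- p * y powr (p - 1)) * (x - y)"
    using assms by (intro convex_on_above_tangent_pos) auto
  then show ?thesis by simp
qed

lemma quadratic_form_nonneg:
  fixes P Q C h k :: real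
  assumes "P > 0" "C\<^sup>2 \<le> P * Q"
  shows "P * k\<^sup>2 - 2 * C * h * k + Q * h\<^sup>2 \<ge> 0"
proof -
  have "P * (P * k\<^sup>2 - 2 * C * h * k + Q * h\<^sup>2) = (P * k - C * h)\<^sup>2 + (P * Q - C\<^sup>2) * h\<^sup>2"
    by (simp add: power2_eq_square algebra_simps)
  also have "\<dots> \<ge> 0" using assms by simp
  finally show ?thesis using assms(1) by (simp add: zero_le_mult_iff)
qed

text \<open>The Hessian determinant is handled by the tangent inequality for the concave function
  \<open>x powr p\<close>, used once at each of the two points; the case \<open>p = 0\<close> covers the logarithm.\<close>

lemma powr_hessian_nonneg:
  fixes p x y h k :: real
  assumes p: "0 \<le> p" "p \<le> 1" and pos: "x > 0" "y > 0"
  shows "((p - 1) * y powr (p - 2) * k\<^sup>2 - (p - 1) * x powr (p - 2) * h\<^sup>2) * (y - x)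
    + 2 * (y powr (p - 1) * k - x powr (p - 1) * h) * (k - h) \<ge> 0"
proof -
  define A where "A = x powr (p - 2)"
  define B where "B = y powr (p - 2)"
  have AB: "A > 0" "B > 0" using pos by (auto simp: A_def B_def)
  have e: "z powr (p - 1) = z * z powr (p - 2)" "z powr p = z\<^sup>2 * z powr (p - 2)" if "z > 0" for z
    using that powr_add[of z 1 "p - 2"] powr_add[of z 2 "p - 2"] by (auto simp: algebra_simps)
  have tx: "x\<^sup>2 * A \<le> B * ((1 - p) * y\<^sup>2 + p * x * y)"
    using powr_le_tangent[OF p pos] pos unfolding e[OF pos(1)] e[OF pos(2)] A_def B_def
    by (simp add: power2_eq_square algebra_simps)
  have ty: "y\<^sup>2 * B \<le> A * ((1 - p) * x\<^sup>2 + p * x * y)"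
    using powr_le_tangent[OF p pos(2,1)] pos unfolding e[OF pos(1)] e[OF pos(2)] A_def B_def
    by (simp add: power2_eq_square algebra_simps)
  \<comment> \<open>P, Q and C are the coefficients of the Hessian form in the directions k and h.
    Each square in C^2 is bounded by one tangent inequality, and the determinant then exceeds 0 by
    at least A * B * p * (1 - p) * (x - y)^2.\<close>
  define P where "P = B * ((1 + p) * y + (1 - p) * x)"
  define Q where "Q = A * ((1 + p) * x + (1 - p) * y)"
  define C where "C = x * A + y * B"
  have "P > 0" using AB p pos unfolding P_def
    by (intro mult_pos_pos add_pos_nonneg mult_nonneg_nonneg) auto
  have "C\<^sup>2 = A * (x\<^sup>2 * A) + B * (y\<^sup>2 * B) + 2 * x * y * A * B"
    by (simp add: C_def power2_eq_square algebra_simps)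
  also have "\<dots> \<le> A * (B * ((1 - p) * y\<^sup>2 + p * x * y)) + B * (A * ((1 - p) * x\<^sup>2 + p * x * y))
      + 2 * x * y * A * B"
    using tx ty AB pos by (intro add_mono mult_left_mono) auto
  also have "\<dots> = P * Q - A * B * (p * (1 - p) * (x - y)\<^sup>2)"
    by (simp add: P_def Q_def power2_eq_square algebra_simps)
  also have "\<dots> \<le> P * Q" using AB p by simp
  finally have "P * k\<^sup>2 - 2 * C * h * k + Q * h\<^sup>2 \<ge> 0"
    using \<open>P > 0\<close> by (intro quadratic_form_nonneg)
  also have "P * k\<^sup>2 - 2 * C * h * k + Q * h\<^sup>2 =
      ((p - 1) * B * k\<^sup>2 - (p - 1) * A * h\<^sup>2) * (y - x) + 2 * (y * B * k - x * A * h) * (k - h)"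
    by (simp add: P_def Q_def C_def power2_eq_square algebra_simps)
  finally show ?thesis unfolding e(1)[OF pos(1)] e(1)[OF pos(2)] A_def B_def .
qed

text \<open>Prescribing only the derivative of \<psi> treats the logarithm (p = 0), the powers and
  the identity (p = 1) at once. Convexity in the plane is tested along segments, where it becomes a
  second derivative test in one variable.\<close>

lemma convex_on_increment_product:
  fixes p :: real and \<psi> :: "real \<Rightarrow> real"
  assumes p: "0 \<le> p" "p \<le> 1"
    and deriv: "\<And>x. x > 0 \<Longrightarrow> (\<psi> has_real_derivative x powr (p - 1)) (at x)"
  shows "convex_on ({0<..} \<times> {0<..}) (\<lambda>(a, b). (\<psi> b - \<psi> a) * (b - a))"
proof (rule convex_onI)
  show "convex ({0::real<..} \<times> {0::real<..})" by (intro convex_Times) auto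
next
  fix t :: real and x y :: "real \<times> real"
  assume t: "0 < t" "t < 1" and xy: "x \<in> {0<..} \<times> {0<..}" "y \<in> {0<..} \<times> {0<..}"
  obtain a b where x: "x = (a, b)" "a > 0" "b > 0" using xy by auto
  obtain a' b' where y: "y = (a', b')" "a' > 0" "b' > 0" using xy by auto
  define X where "X = (\<lambda>s. (1 - s) * a + s * a')"
  define Y where "Y = (\<lambda>s. (1 - s) * b + s * b')"
  define h where "h = a' - a"
  define k where "k = b' - b"
  have pos: "X s > 0 \<and> Y s > 0" if "s \<in> {0..1}" for s
    using that x y by (simp add: X_def Y_def convex_combination_pos)
  have dX: "(X has_real_derivative h) (at s)" for s
    unfolding X_def h_def by (auto intro!: derivative_eq_intros)
  have dY: "(Y has_real_derivative k) (at s)" for s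
    unfolding Y_def k_def by (auto intro!: derivative_eq_intros)
  define g where "g = (\<lambda>s. (\<psi> (Y s) - \<psi> (X s)) * (Y s - X s))"
  have "convex_on {0..1} g"
  proof (rule f''_ge0_imp_convex)
    fix s :: real assume s: "s \<in> {0..1}"
    note pos = pos[OF s, THEN conjunct1] pos[OF s, THEN conjunct2]
    note dpsi = DERIV_chain2[OF deriv[OF pos(1)] dX] DERIV_chain2[OF deriv[OF pos(2)] dY]
    show "(g has_real_derivative ((Y s powr (p - 1) * k - X s powr (p - 1) * h) * (Y s - X s)
        + (\<psi> (Y s) - \<psi> (X s)) * (k - h))) (at s)"
      unfolding g_def by (rule derivative_eq_intros dpsi dX dY refl)+ (simp add: algebra_simps)
    have dp: "((\<lambda>z. z powr (p - 1)) has_real_derivative (p - 1) * z powr (p - 2)) (at z)"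
      if "z > 0" for z
      using that by (auto intro!: derivative_eq_intros)
    note dp' = DERIV_chain2[OF dp[OF pos(1)] dX] DERIV_chain2[OF dp[OF pos(2)] dY]
    show "((\<lambda>s. (Y s powr (p - 1) * k - X s powr (p - 1) * h) * (Y s - X s)
        + (\<psi> (Y s) - \<psi> (X s)) * (k - h)) has_real_derivative
        (((p - 1) * Y s powr (p - 2) * k\<^sup>2 - (p - 1) * X s powr (p - 2) * h\<^sup>2) * (Y s - X s)
        + 2 * (Y s powr (p - 1) * k - X s powr (p - 1) * h) * (k - h))) (at s)"
      by (rule derivative_eq_intros dpsi dp' dX dY refl)+
        (simp add: algebra_simps power2_eq_square)
    show "((p - 1) * Y s powr (p - 2) * k\<^sup>2 - (p - 1) * X s powr (p - 2) * h\<^sup>2) * (Y s - X s)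
        + 2 * (Y s powr (p - 1) * k - X s powr (p - 1) * h) * (k - h) \<ge> 0"
      by (rule powr_hessian_nonneg[OF p pos])
  qed simp
  from convex_onD[OF this, of t 0 1] t have "g t \<le> (1 - t) * g 0 + t * g 1" by simp
  then show "(\<lambda>(a, b). (\<psi> b - \<psi> a) * (b - a)) ((1 - t) *\<^sub>R x + t *\<^sub>R y)
      \<le> (1 - t) * (\<lambda>(a, b). (\<psi> b - \<psi> a) * (b - a)) x + t * (\<lambda>(a, b). (\<psi> b - \<psi> a) * (b - a)) y"
    by (simp add: g_def X_def Y_def x y)
qed

text \<open>The last clause measures the gain from moving the two arguments towards each other;
  for \<open>\<beta> = 1\<close> it is a consequence of convexity.\<close>

definition edge_convex :: "real \<Rightarrow> (real \<Rightarrow> real \<Rightarrow> real) \<Rightarrow> bool" where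
  "edge_convex \<beta> \<Psi> \<longleftrightarrow>
     convex_on ({0<..} \<times> {0<..}) (\<lambda>(a, b). \<Psi> a b) \<and>
     (\<forall>a>0. \<forall>b>0. \<Psi> a b \<ge> 0 \<and> \<Psi> a b = \<Psi> b a) \<and>
     (\<forall>a>0. \<forall>b>0. \<forall>s\<ge>0. \<forall>t\<ge>0. s + t \<le> 1 \<longrightarrow>
        \<Psi> ((1 - s) * a + s * b) ((1 - t) * b + t * a)
          \<le> (1 - (s + t)) * (1 - (\<beta> - 1) * (s + t)) * \<Psi> a b)"

text \<open>Jensen's inequality with a distinguished extra point, indexed by \<open>None\<close>. In
  the coupling this point carries the mass that does not jump.\<close>

lemma convex_on_sum_base:
  fixes f :: "'b::real_vector \<Rightarrow> real"
  assumes f: "convex_on C f" and I: "finite I"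
    and w: "\<And>i. i \<in> I \<Longrightarrow> w i \<ge> 0" "A \<ge> 0" "A + sum w I = 1"
    and C: "x \<in> C" "\<And>i. i \<in> I \<Longrightarrow> y i \<in> C"
  shows "f (A *\<^sub>R x + (\<Sum>i\<in>I. w i *\<^sub>R y i)) \<le> A * f x + (\<Sum>i\<in>I. w i * f (y i))"
proof -
  define J where "J = insert None (Some ` I)"
  define u where "u = (\<lambda>j. case j of None \<Rightarrow> A | Some i \<Rightarrow> w i)"
  define z where "z = (\<lambda>j. case j of None \<Rightarrow> x | Some i \<Rightarrow> y i)"
  have *: "(\<Sum>j\<in>J. g j) = g None + (\<Sum>i\<in>I. g (Some i))"
    for g :: "'a option \<Rightarrow> 'c::comm_monoid_add"
    using I by (simp add: J_def sum.reindex)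
  have "f (\<Sum>j\<in>J. u j *\<^sub>R z j) \<le> (\<Sum>j\<in>J. u j * f (z j))"
    by (rule convex_on_sum[OF _ _ f])
      (use w C I in \<open>auto simp: * u_def\<close>, auto simp: J_def u_def z_def)
  then show ?thesis by (simp add: * u_def z_def)
qed

text \<open>The pair moved inwards is the convex combination of (a, b), (b, b) and (a, a) with
  weights 1 - s - t, s and t, and \<Psi> vanishes at the last two.\<close>

lemma edge_convexI1:
  assumes conv: "convex_on ({0<..} \<times> {0<..}) (\<lambda>(a, b). \<Psi> a b)"
    and nn: "\<And>a b. a > 0 \<Longrightarrow> b > 0 \<Longrightarrow> \<Psi> a b \<ge> 0"
    and sym: "\<And>a b. a > 0 \<Longrightarrow> b > 0 \<Longrightarrow> \<Psi> a b = \<Psi> b a"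
    and diag: "\<And>a. a > 0 \<Longrightarrow> \<Psi> a a = 0"
  shows "edge_convex 1 \<Psi>"
proof -
  have "\<Psi> ((1 - s) * a + s * b) ((1 - t) * b + t * a) \<le> (1 - (s + t)) * \<Psi> a b"
    if "a > 0" "b > 0" "s \<ge> 0" "t \<ge> 0" "s + t \<le> 1" for a b s t
  proof -
    have "(\<lambda>(a, b). \<Psi> a b) ((1 - s - t) *\<^sub>R (a, b) + (\<Sum>i\<in>UNIV. (if i then s else t) *\<^sub>R (if i then (b, b) else (a, a))))
      \<le> (1 - s - t) * (\<lambda>(a, b). \<Psi> a b) (a, b) + (\<Sum>i\<in>UNIV. (if i then s else t) * (\<lambda>(a, b). \<Psi> a b) (if i then (b, b) else (a, a)))"
      by (rule convex_on_sum_base[OF conv]) (use that in \<open>auto simp: UNIV_bool\<close>)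
    then show ?thesis using that by (simp add: UNIV_bool diag algebra_simps)
  qed
  then show ?thesis using assms by (auto simp: edge_convex_def)
qed

text \<open>Serves to show that the iterates converge to their mean. The energy of \<phi> itself
  cannot do this in general: for an affine \<phi> it is identically 0.\<close>

lemma edge_convex_square_dist: "edge_convex 1 (\<lambda>a b. (b - a)\<^sup>2)"
proof (rule edge_convexI1)
  have "convex_on ({0<..} \<times> {0<..}) (\<lambda>(a, b). (b - a) * (b - a :: real))"
    by (rule convex_on_increment_product[where p = 1]) auto
  then show "convex_on ({0<..} \<times> {0<..}) (\<lambda>(a, b). (b - a :: real)\<^sup>2)"
    by (simp add: power2_eq_square)
qed (auto simp: power2_commute)

text \<open>Moving inwards shortens b - a by exactly the factor 1 - (s + t). The second factor is
  the shrinking of the increment of x^p, which concavity bounds by 1 - p * (s + t).\<close>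

lemma edge_convex_powr:
  fixes p :: real
  assumes p: "0 < p" "p \<le> 1"
  shows "edge_convex (1 + p) (\<lambda>a b. (b powr p - a powr p) * (b - a))"
proof -
  define \<psi> where "\<psi> = (\<lambda>x::real. x powr p)"
  have "convex_on ({0<..} \<times> {0<..}) (\<lambda>(a, b). (b powr p / p - a powr p / p) * (b - a))"
    using p by (intro convex_on_increment_product[where p = p]) (auto intro!: derivative_eq_intros)
  then have "convex_on ({0<..} \<times> {0<..}) (\<lambda>x. p * (\<lambda>(a, b). (b powr p / p - a powr p / p) * (b - a)) x)"
    using p by (intro convex_on_cmul) auto
  moreover have "(\<lambda>x. p * (\<lambda>(a, b). (b powr p / p - a powr p / p) * (b - a)) x)
      = (\<lambda>(a, b). (b powr p - a powr p) * (b - a))"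
    using p by (auto simp: fun_eq_iff field_simps)
  ultimately have conv: "convex_on ({0<..} \<times> {0<..}) (\<lambda>(a, b). (b powr p - a powr p) * (b - a))"
    by simp
  have nn: "(b powr p - a powr p) * (b - a) \<ge> 0" if "a > 0" "b > 0" for a b
  proof (cases "a \<le> b")
    case True
    then show ?thesis using powr_mono2[of p a b] that p by simp
  next
    case False
    then show ?thesis using powr_mono2[of p b a] that p by (simp add: mult_nonpos_nonpos)
  qed
  have tan: "\<psi> x \<le> \<psi> y + p * y powr (p - 1) * (x - y)" if "x > 0" "y > 0" for x y
    using powr_le_tangent[of p x y] that p by (simp add: \<psi>_def)
  \<comment> \<open>The tangent at b gives \<psi> b - \<psi> a \<ge> p * b powr (p - 1) * (b - a).
    The reverse bound holds without the factor p, and this p is the gain per unit of movement of the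
    upper end point.\<close>
  have decr: "b powr (p - 1) * (b - a) \<ge> \<psi> b - \<psi> a" if "0 < a" "a \<le> b" for a b
  proof -
    have e: "z powr p = z powr (p - 1) * z" if "z > 0" for z
      using that powr_add[of z "p - 1" 1] by simp
    have "b powr (p - 1) \<le> a powr (p - 1)" using that p by (intro powr_mono2') auto
    then have "b powr (p - 1) * a \<le> a powr (p - 1) * a" using that by simp
    then show ?thesis using that by (simp add: \<psi>_def e[of a] e[of b] algebra_simps)
  qed
  have gain: "\<psi> ((1 - t) * b + t * a) - \<psi> ((1 - s) * a + s * b) \<le> (1 - p * (s + t)) * (\<psi> b - \<psi> a)"
    if ab: "0 < a" "a \<le> b" and st: "0 \<le> s" "0 \<le> t" "s + t \<le> 1" for a b s t
  proof -
    have pos: "(1 - t) * b + t * a > 0" "(1 - s) * a + s * b > 0"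
      using ab st by (auto intro!: convex_combination_pos)
    have mono: "\<psi> b \<ge> \<psi> a" using powr_mono2[of p a b] ab p by (simp add: \<psi>_def)
    have "\<psi> ((1 - t) * b + t * a) \<le> \<psi> b - (p * t) * (b powr (p - 1) * (b - a))"
      using tan[of "(1 - t) * b + t * a" b] pos ab by (simp add: algebra_simps)
    also have "\<dots> \<le> \<psi> b - (p * t) * (\<psi> b - \<psi> a)"
      using decr[OF ab] p st by (intro diff_left_mono mult_left_mono) auto
    finally have 1: "\<psi> ((1 - t) * b + t * a) \<le> \<psi> b - (p * t) * (\<psi> b - \<psi> a)" .
    define z where "z = (1 - s) * a + s * b"
    have "(1 - s) * \<psi> a \<le> (1 - s) * (\<psi> z + p * z powr (p - 1) * (a - z))"
      using tan[of a z] ab pos st by (intro mult_left_mono) (auto simp: z_def)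
    moreover have "s * \<psi> b \<le> s * (\<psi> z + p * z powr (p - 1) * (b - z))"
      using tan[of b z] ab pos st by (intro mult_left_mono) (auto simp: z_def)
    moreover have "(1 - s) * (\<psi> z + p * z powr (p - 1) * (a - z)) + s * (\<psi> z + p * z powr (p - 1) * (b - z))
      = \<psi> z + p * z powr (p - 1) * ((1 - s) * a + s * b - z)"
      by (simp add: algebra_simps)
    ultimately have "(1 - s) * \<psi> a + s * \<psi> b \<le> \<psi> z"
      by (simp add: z_def[symmetric])
    \<comment> \<open>The lower end point gains the full s by concavity; weakening s to p * s lets
      both end points contribute in the same form.\<close>
    moreover have "s * (p * (\<psi> b - \<psi> a)) \<le> s * (\<psi> b - \<psi> a)"
      using p st mono by (intro mult_left_mono mult_left_le_one_le) auto
    ultimately have "\<psi> z \<ge> \<psi> a + (p * s) * (\<psi> b - \<psi> a)"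
      by (simp add: algebra_simps)
    with 1 show ?thesis unfolding z_def by (simp add: algebra_simps)
  qed
  have main: "(\<psi> ((1 - t) * b + t * a) - \<psi> ((1 - s) * a + s * b)) * ((1 - t) * b + t * a - ((1 - s) * a + s * b))
      \<le> (1 - (s + t)) * (1 - p * (s + t)) * ((\<psi> b - \<psi> a) * (b - a))"
    if ab: "0 < a" "a \<le> b" and st: "0 \<le> s" "0 \<le> t" "s + t \<le> 1" for a b s t
  proof -
    have "(\<psi> ((1 - t) * b + t * a) - \<psi> ((1 - s) * a + s * b)) * ((1 - (s + t)) * (b - a))
      \<le> ((1 - p * (s + t)) * (\<psi> b - \<psi> a)) * ((1 - (s + t)) * (b - a))"
      using gain[OF that] ab st by (intro mult_right_mono) auto
    moreover have "(1 - t) * b + t * a - ((1 - s) * a + s * b) = (1 - (s + t)) * (b - a)"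
      by (simp add: algebra_simps)
    ultimately show ?thesis by (simp add: ac_simps)
  qed
  have "(\<psi> ((1 - t) * b + t * a) - \<psi> ((1 - s) * a + s * b)) * ((1 - t) * b + t * a - ((1 - s) * a + s * b))
      \<le> (1 - (s + t)) * (1 - p * (s + t)) * ((\<psi> b - \<psi> a) * (b - a))"
    if ab: "0 < a" "0 < b" and st: "0 \<le> s" "0 \<le> t" "s + t \<le> 1" for a b s t
  proof (cases "a \<le> b")
    case True
    then show ?thesis using main that by blast
  next
    case False
    then show ?thesis using main[of b a t s] that by (simp add: algebra_simps)
  qed
  then show ?thesis using conv nn
    unfolding edge_convex_def \<psi>_def by (auto simp: algebra_simps)
qed

text \<open>\<open>Phi\<close> is built from \<open>deriv\<close>, whose value is computed only at
  positive arguments, so closed forms agree with it on the open quadrant alone.\<close>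

lemma edge_convex_cong:
  assumes \<Psi>: "edge_convex \<beta> \<Psi>" and eq: "\<And>a b. a > 0 \<Longrightarrow> b > 0 \<Longrightarrow> \<Psi>' a b = \<Psi> a b"
  shows "edge_convex \<beta> \<Psi>'"
proof -
  have "convex_on ({0<..} \<times> {0<..}) (\<lambda>(a, b). \<Psi>' a b)"
  proof (rule convex_onI)
    show "convex ({0::real<..} \<times> {0::real<..})" by (intro convex_Times) auto
    fix t :: real and x y :: "real \<times> real"
    assume t: "0 < t" "t < 1" and xy: "x \<in> {0<..} \<times> {0<..}" "y \<in> {0<..} \<times> {0<..}"
    have "(\<lambda>(a, b). \<Psi> a b) ((1 - t) *\<^sub>R x + t *\<^sub>R y)
        \<le> (1 - t) * (\<lambda>(a, b). \<Psi> a b) x + t * (\<lambda>(a, b). \<Psi> a b) y"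
      using \<Psi> t xy unfolding edge_convex_def by (intro convex_onD[of "{0<..} \<times> {0<..}"]) auto
    then show "(\<lambda>(a, b). \<Psi>' a b) ((1 - t) *\<^sub>R x + t *\<^sub>R y)
        \<le> (1 - t) * (\<lambda>(a, b). \<Psi>' a b) x + t * (\<lambda>(a, b). \<Psi>' a b) y"
      using t xy by (auto simp: eq convex_combination_pos split: prod.splits)
  qed
  then show ?thesis using \<Psi> unfolding edge_convex_def by (simp add: eq convex_combination_pos)
qed

lemma edge_convex_cmult:
  assumes \<Psi>: "edge_convex \<beta> \<Psi>" and k: "k \<ge> 0"
  shows "edge_convex \<beta> (\<lambda>a b. k * \<Psi> a b)"
proof -
  have "convex_on ({0<..} \<times> {0<..}) (\<lambda>x. k * (\<lambda>(a, b). \<Psi> a b) x)"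
    using \<Psi> k unfolding edge_convex_def by (intro convex_on_cmul) auto
  moreover have "(\<lambda>x. k * (\<lambda>(a, b). \<Psi> a b) x) = (\<lambda>(a, b). k * \<Psi> a b)" by auto
  moreover have "k * \<Psi> ((1 - s) * a + s * b) ((1 - t) * b + t * a)
      \<le> (1 - (s + t)) * (1 - (\<beta> - 1) * (s + t)) * (k * \<Psi> a b)"
    if "a > 0" "b > 0" "s \<ge> 0" "t \<ge> 0" "s + t \<le> 1" for a b s t
  proof -
    have "k * \<Psi> ((1 - s) * a + s * b) ((1 - t) * b + t * a)
        \<le> k * ((1 - (s + t)) * (1 - (\<beta> - 1) * (s + t)) * \<Psi> a b)"
      using \<Psi> k that unfolding edge_convex_def by (intro mult_left_mono) auto
    then show ?thesis by (simp only: mult_ac)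
  qed
  ultimately show ?thesis using \<Psi> k unfolding edge_convex_def by simp
qed

section \<open>Edge functions of the admissible, logarithmic and power entropies\<close>

lemma edge_convex_Phi_admissible:
  assumes "admissible \<phi>"
  shows "edge_convex 1 (Phi \<phi>)"
proof (rule edge_convexI1)
  show "convex_on ({0<..} \<times> {0<..}) (\<lambda>(a, b). Phi \<phi> a b)"
    using assms by (simp add: admissible_def)
  have conv: "convex_on {0<..} \<phi>"
    using assms unfolding admissible_def by (auto intro: convex_on_subset)
  have tangent: "\<phi> b - \<phi> a \<ge> deriv \<phi> a * (b - a)" if "a > 0" "b > 0" for a b
    using assms that by (intro convex_on_above_tangent_pos[OF conv])
      (auto simp: admissible_def DERIV_deriv_iff_real_differentiable)
  show "Phi \<phi> a b \<ge> 0" if "a > 0" "b > 0" for a b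
    using tangent[OF that] tangent[OF that(2,1)] by (simp add: Phi_def algebra_simps)
qed (auto simp: Phi_def algebra_simps)

text \<open>The affine terms in \<open>phi_1\<close> and \<open>phi_alpha\<close> are chosen so that
  value and derivative vanish at 1; convexity then gives nonnegativity.\<close>

lemma convex_nonneg_of_critical:
  fixes \<phi> :: "real \<Rightarrow> real"
  assumes "convex_on {0<..} \<phi>" "(\<phi> has_real_derivative 0) (at 1)" "\<phi> 1 = 0" "a > 0"
  shows "\<phi> a \<ge> 0"
  using convex_on_above_tangent_pos[OF assms(1,2) _ assms(4)] assms(3) by simp

lemma DERIV_phi_1: "a > 0 \<Longrightarrow> (phi_1 has_real_derivative ln a) (at a)"
  unfolding phi_1_def[abs_def] by (auto intro!: derivative_eq_intros)

lemma convex_on_phi_1: "convex_on {0<..} phi_1"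
proof (rule f''_ge0_imp_convex)
  show "(ln has_real_derivative 1 / a) (at a)" if "a \<in> {0<..}" for a :: real
    using that by (auto intro!: derivative_eq_intros)
qed (auto intro: DERIV_phi_1)

lemma edge_convex_phi_1: "edge_convex 1 (Phi phi_1)"
proof (rule edge_convex_cong)
  show "edge_convex 1 (\<lambda>a b. (ln b - ln a) * (b - a :: real))"
  proof (rule edge_convexI1)
    show "convex_on ({0<..} \<times> {0<..}) (\<lambda>(a, b). (ln b - ln a) * (b - a :: real))"
      by (rule convex_on_increment_product[where p = 0])
        (auto intro!: derivative_eq_intros simp: powr_minus field_simps)
    show "(ln b - ln a) * (b - a) \<ge> 0" if "a > 0" "b > 0" for a b :: real
      using that by (cases "a \<le> b") (auto simp: mult_nonpos_nonpos)
  qed (auto simp: algebra_simps)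
qed (simp add: Phi_def DERIV_imp_deriv[OF DERIV_phi_1])

lemma DERIV_phi_alpha:
  "a > 0 \<Longrightarrow> (phi_alpha \<alpha> has_real_derivative (\<alpha> * a powr (\<alpha> - 1) - 1) / (\<alpha> - 1) - 1) (at a)"
  unfolding phi_alpha_def[abs_def] by (cases "\<alpha> = 1") (auto intro!: derivative_eq_intros)

lemma convex_on_phi_alpha:
  assumes "\<alpha> > 1"
  shows "convex_on {0<..} (phi_alpha \<alpha>)"
proof (rule f''_ge0_imp_convex)
  show "((\<lambda>a. (\<alpha> * a powr (\<alpha> - 1) - 1) / (\<alpha> - 1) - 1) has_real_derivative
      \<alpha> * a powr (\<alpha> - 2)) (at a)" if "a \<in> {0<..}" for a
    using that assms by (auto intro!: derivative_eq_intros)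
qed (use assms in \<open>auto intro: DERIV_phi_alpha\<close>)

text \<open>Up to a constant factor this is the edge function of the power p = \<alpha> - 1, so the
  gain parameter 1 + p equals \<alpha>. This is the origin of the Beckner constant.\<close>

lemma edge_convex_phi_alpha:
  assumes "1 < \<alpha>" "\<alpha> \<le> 2"
  shows "edge_convex \<alpha> (Phi (phi_alpha \<alpha>))"
proof (rule edge_convex_cong)
  have "edge_convex (1 + (\<alpha> - 1)) (\<lambda>a b. \<alpha> / (\<alpha> - 1) * ((b powr (\<alpha> - 1) - a powr (\<alpha> - 1)) * (b - a)))"
    using assms by (intro edge_convex_cmult edge_convex_powr) auto
  then show "edge_convex \<alpha> (\<lambda>a b. \<alpha> / (\<alpha> - 1) * ((b powr (\<alpha> - 1) - a powr (\<alpha> - 1)) * (b - a)))"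
    by simp
  fix a b :: real
  assume "a > 0" "b > 0"
  then have "Phi (phi_alpha \<alpha>) a b
      = ((\<alpha> * b powr (\<alpha> - 1) - 1) / (\<alpha> - 1) - (\<alpha> * a powr (\<alpha> - 1) - 1) / (\<alpha> - 1)) * (b - a)"
    by (simp add: Phi_def DERIV_imp_deriv[OF DERIV_phi_alpha])
  also have "\<dots> = \<alpha> / (\<alpha> - 1) * ((b powr (\<alpha> - 1) - a powr (\<alpha> - 1)) * (b - a))"
    by (simp add: diff_divide_distrib algebra_simps)
  finally show "Phi (phi_alpha \<alpha>) a b
      = \<alpha> / (\<alpha> - 1) * ((b powr (\<alpha> - 1) - a powr (\<alpha> - 1)) * (b - a))" .
qed

text \<open>One coupled step from the edge (a, b): \<open>r0\<close> moves both ends,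
  \<open>r1\<close> moves the second end while the first jumps onto b, \<open>r2\<close> moves the
  first end while the second jumps onto a, and \<open>kp\<close>, \<open>km\<close> merge the ends.
  The factor 1 - \<epsilon> * M is the price of a positive step size.\<close>

lemma edge_convex_coupling_step:
  fixes a b \<epsilon> M kp km \<beta> :: real and r0 r1 r2 x y :: "'s::finite \<Rightarrow> real"
  assumes \<Psi>: "edge_convex \<beta> \<Psi>" and \<beta>: "\<beta> \<ge> 1"
    and pos: "a > 0" "b > 0" "\<And>\<sigma>. x \<sigma> > 0" "\<And>\<sigma>. y \<sigma> > 0"
    and rates: "kp \<ge> 0" "km \<ge> 0" "\<And>\<sigma>. r0 \<sigma> \<ge> 0" "\<And>\<sigma>. r1 \<sigma> \<ge> 0" "\<And>\<sigma>. r2 \<sigma> \<ge> 0"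
    and M: "(\<Sum>\<sigma>\<in>UNIV. r0 \<sigma> + r1 \<sigma> + r2 \<sigma>) + kp + km \<le> M"
    and \<epsilon>: "\<epsilon> > 0" "\<epsilon> * M < 1"
  shows "\<Psi> (a + \<epsilon> * ((\<Sum>\<sigma>\<in>UNIV. (r0 \<sigma> + r2 \<sigma>) * (x \<sigma> - a) + r1 \<sigma> * (b - a)) + kp * (b - a)))
           (b + \<epsilon> * ((\<Sum>\<sigma>\<in>UNIV. (r0 \<sigma> + r1 \<sigma>) * (y \<sigma> - b) + r2 \<sigma> * (a - b)) + km * (a - b)))
    \<le> (1 - \<epsilon> * (kp + km) * (1 + (\<beta> - 1) * (1 - \<epsilon> * M))) * \<Psi> a b
      + \<epsilon> * (\<Sum>\<sigma>\<in>UNIV. r0 \<sigma> * (\<Psi> (x \<sigma>) (y \<sigma>) - \<Psi> a b)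
          + r1 \<sigma> * (\<Psi> b (y \<sigma>) - \<Psi> a b) + r2 \<sigma> * (\<Psi> (x \<sigma>) a - \<Psi> a b))"
proof -
  define R where "R = (\<Sum>\<sigma>\<in>UNIV. r0 \<sigma> + r1 \<sigma> + r2 \<sigma>)"
  define K where "K = kp + km"
  define A where "A = 1 - \<epsilon> * R"
  \<comment> \<open>Resting mass and merging mass are pooled into one pair of mass \<open>A\<close>
    whose ends move inwards by \<open>s\<close> and \<open>t\<close>. Sending the merging mass to
    the diagonal would give only the factor 1 - \<epsilon> * (kp + km); the pooled pair lets the
    last clause of \<open>edge_convex\<close> add the gain for \<beta> > 1.\<close>
  define s where "s = \<epsilon> * kp / A"
  define t where "t = \<epsilon> * km / A"
  have "R \<ge> 0" unfolding R_def using rates by (intro sum_nonneg add_nonneg_nonneg) auto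
  have "K \<ge> 0" using rates by (simp add: K_def)
  have "\<epsilon> * (R + K) \<le> \<epsilon> * M" using M \<epsilon> by (intro mult_left_mono) (auto simp: R_def K_def)
  then have AK: "A - \<epsilon> * K \<ge> 1 - \<epsilon> * M" by (simp add: A_def algebra_simps)
  have "\<epsilon> * K \<ge> 0" using \<epsilon> \<open>K \<ge> 0\<close> by simp
  then have "A > 0" using AK \<epsilon> by linarith
  have "A \<le> 1" using \<open>R \<ge> 0\<close> \<epsilon> by (simp add: A_def)
  have st: "s \<ge> 0" "t \<ge> 0" "s + t = \<epsilon> * K / A"
    using \<open>A > 0\<close> rates \<epsilon> by (auto simp: s_def t_def K_def field_simps)
  have st1: "s + t \<le> 1" unfolding st(3) using AK \<epsilon> \<open>A > 0\<close> by (simp add: pos_divide_le_eq)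
  define p where "p = ((1 - s) * a + s * b, (1 - t) * b + t * a)"
  have ppos: "p \<in> {0<..} \<times> {0<..}" using pos st st1 unfolding p_def by (auto intro!: convex_combination_pos)
  \<comment> \<open>The label n = 0, 1, 2 tells which of \<open>r0\<close>, \<open>r1\<close>,
    \<open>r2\<close> the jump belongs to.\<close>
  define w where "w = (\<lambda>(\<sigma>, n::nat). \<epsilon> * (if n = 0 then r0 \<sigma> else if n = Suc 0 then r1 \<sigma> else r2 \<sigma>))"
  define z where "z = (\<lambda>(\<sigma>, n::nat). if n = 0 then (x \<sigma>, y \<sigma>) else if n = Suc 0 then (b, y \<sigma>) else (x \<sigma>, a))"
  let ?I = "(UNIV :: 's set) \<times> {0, Suc 0, 2}"
  have sumI: "(\<Sum>i\<in>?I. g i) = (\<Sum>\<sigma>\<in>UNIV. g (\<sigma>, 0) + g (\<sigma>, Suc 0) + g (\<sigma>, 2))"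
    for g :: "'s \<times> nat \<Rightarrow> 'v::comm_monoid_add"
    by (simp add: sum.cartesian_product' add.assoc)
  have As: "A * s = \<epsilon> * kp" "A * t = \<epsilon> * km" using \<open>A > 0\<close> by (auto simp: s_def t_def)
  have conv: "convex_on ({0<..} \<times> {0<..}) (\<lambda>(a, b). \<Psi> a b)" using \<Psi> by (simp add: edge_convex_def)
  have "(\<lambda>(a, b). \<Psi> a b) (A *\<^sub>R p + (\<Sum>i\<in>?I. w i *\<^sub>R z i))
      \<le> A * (\<lambda>(a, b). \<Psi> a b) p + (\<Sum>i\<in>?I. w i * (\<lambda>(a, b). \<Psi> a b) (z i))"
  proof (rule convex_on_sum_base[OF conv])
    show "w i \<ge> 0" if "i \<in> ?I" for i using that rates \<epsilon> by (auto simp: w_def)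
    show "z i \<in> {0<..} \<times> {0<..}" if "i \<in> ?I" for i using that pos by (auto simp: z_def)
    have "sum w ?I = \<epsilon> * R"
      unfolding sumI by (simp add: w_def R_def sum_distrib_left distrib_left)
    then show "A + sum w ?I = 1" by (simp add: A_def)
  qed (use \<open>A > 0\<close> ppos in auto)
  also have "(\<Sum>i\<in>?I. w i * (\<lambda>(a, b). \<Psi> a b) (z i)) =
      \<epsilon> * (\<Sum>\<sigma>\<in>UNIV. r0 \<sigma> * \<Psi> (x \<sigma>) (y \<sigma>) + r1 \<sigma> * \<Psi> b (y \<sigma>) + r2 \<sigma> * \<Psi> (x \<sigma>) a)"
    by (simp add: sumI) (simp add: w_def z_def sum_distrib_left algebra_simps)
  also have "\<dots> = \<epsilon> * (\<Sum>\<sigma>\<in>UNIV. r0 \<sigma> * (\<Psi> (x \<sigma>) (y \<sigma>) - \<Psi> a b)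
      + r1 \<sigma> * (\<Psi> b (y \<sigma>) - \<Psi> a b) + r2 \<sigma> * (\<Psi> (x \<sigma>) a - \<Psi> a b)) + \<epsilon> * R * \<Psi> a b"
    by (simp add: R_def sum_distrib_left sum_distrib_right sum.distrib[symmetric] algebra_simps)
  also have "(\<lambda>(a, b). \<Psi> a b) p \<le> (1 - (s + t)) * (1 - (\<beta> - 1) * (s + t)) * \<Psi> a b"
    using \<Psi> pos st(1,2) st1 unfolding edge_convex_def p_def by simp
  also have "A *\<^sub>R p + (\<Sum>i\<in>?I. w i *\<^sub>R z i) =
      (a + \<epsilon> * ((\<Sum>\<sigma>\<in>UNIV. (r0 \<sigma> + r2 \<sigma>) * (x \<sigma> - a) + r1 \<sigma> * (b - a)) + kp * (b - a)),
       b + \<epsilon> * ((\<Sum>\<sigma>\<in>UNIV. (r0 \<sigma> + r1 \<sigma>) * (y \<sigma> - b) + r2 \<sigma> * (a - b)) + km * (a - b)))"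
    (is "?l = ?r")
  proof (rule prod_eqI)
    have "fst ?l = A * a + (A * s) * (b - a) + \<epsilon> * (\<Sum>\<sigma>\<in>UNIV. r0 \<sigma> * x \<sigma> + r1 \<sigma> * b + r2 \<sigma> * x \<sigma>)"
      by (simp add: sumI p_def fst_sum) (simp add: w_def z_def sum_distrib_left algebra_simps)
    also have "A * a = a - \<epsilon> * (\<Sum>\<sigma>\<in>UNIV. r0 \<sigma> * a + r1 \<sigma> * a + r2 \<sigma> * a)"
      by (simp add: A_def R_def sum_distrib_left algebra_simps)
    finally show "fst ?l = fst ?r"
      unfolding As by (simp add: sum.distrib sum_subtractf sum_distrib_left algebra_simps)
    have "snd ?l = A * b + (A * t) * (a - b) + \<epsilon> * (\<Sum>\<sigma>\<in>UNIV. r0 \<sigma> * y \<sigma> + r1 \<sigma> * y \<sigma> + r2 \<sigma> * a)"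
      by (simp add: sumI p_def snd_sum) (simp add: w_def z_def sum_distrib_left algebra_simps)
    also have "A * b = b - \<epsilon> * (\<Sum>\<sigma>\<in>UNIV. r0 \<sigma> * b + r1 \<sigma> * b + r2 \<sigma> * b)"
      by (simp add: A_def R_def sum_distrib_left algebra_simps)
    finally show "snd ?l = snd ?r"
      unfolding As by (simp add: sum.distrib sum_subtractf sum_distrib_left algebra_simps)
  qed
  finally have main: "(\<lambda>(a, b). \<Psi> a b) ?r \<le> A * ((1 - (s + t)) * (1 - (\<beta> - 1) * (s + t)) * \<Psi> a b)
      + (\<epsilon> * (\<Sum>\<sigma>\<in>UNIV. r0 \<sigma> * (\<Psi> (x \<sigma>) (y \<sigma>) - \<Psi> a b)
      + r1 \<sigma> * (\<Psi> b (y \<sigma>) - \<Psi> a b) + r2 \<sigma> * (\<Psi> (x \<sigma>) a - \<Psi> a b)) + \<epsilon> * R * \<Psi> a b)"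
    using \<open>A > 0\<close> by simp
  \<comment> \<open>The mass left after merging is A - \<epsilon> * K, at least 1 - \<epsilon> * M,
    while s + t is at least \<epsilon> * K because A \<le> 1. Together they produce the factor 1 +
    (\<beta> - 1) * (1 - \<epsilon> * M).\<close>
  have "A * ((1 - (s + t)) * (1 - (\<beta> - 1) * (s + t))) = (A - \<epsilon> * K) * (1 - (\<beta> - 1) * (s + t))"
  proof -
    have "A * (1 - (s + t)) = A - \<epsilon> * K" using \<open>A > 0\<close> by (simp add: st(3) field_simps)
    then show ?thesis by (simp only: mult.assoc[symmetric])
  qed
  also have "\<dots> \<le> (A - \<epsilon> * K) * (1 - (\<beta> - 1) * (\<epsilon> * K))"
  proof -
    have "\<epsilon> * K \<le> s + t"
      using \<open>A \<le> 1\<close> \<open>A > 0\<close> \<open>\<epsilon> * K \<ge> 0\<close> unfolding st(3) by (simp add: mult_left_le pos_le_divide_eq)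
    then show ?thesis using AK \<epsilon> \<beta> by (intro mult_left_mono diff_left_mono) auto
  qed
  also have "\<dots> = A - \<epsilon> * K - (\<beta> - 1) * (\<epsilon> * K) * (A - \<epsilon> * K)" by (simp add: algebra_simps)
  also have "\<dots> \<le> A - \<epsilon> * K - (\<beta> - 1) * (\<epsilon> * K) * (1 - \<epsilon> * M)"
    using AK \<beta> \<epsilon>(1) \<open>K \<ge> 0\<close> by (intro diff_left_mono mult_left_mono mult_nonneg_nonneg) auto
  finally have "A * ((1 - (s + t)) * (1 - (\<beta> - 1) * (s + t))) * \<Psi> a b
      \<le> (A - \<epsilon> * K - (\<beta> - 1) * (\<epsilon> * K) * (1 - \<epsilon> * M)) * \<Psi> a b"
    using \<Psi> pos by (intro mult_right_mono) (auto simp: edge_convex_def)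
  with main show ?thesis
    by (simp add: A_def K_def algebra_simps)
qed

section \<open>Reversible chains on a cube\<close>

text \<open>\<open>m\<close> carries no normalization, so a Gibbs measure can be used as it stands.
  \<open>c_Up_commute\<close> equates the two upward paths around a lattice square; with detailed
  balance this is what makes the transport terms cancel. The curvature bounds are asked only along
  edges inside the cube.\<close>

locale cube_chain =
  fixes c :: "nat ^ 'd::finite \<Rightarrow> 'd move \<Rightarrow> real" and m :: "nat ^ 'd \<Rightarrow> real"
    and N :: nat and k :: real
  assumes m_pos: "m \<eta> > 0"
    and c_nonneg: "c \<eta> \<sigma> \<ge> 0"
    and c_outside: "\<eta> \<notin> cube N \<or> act \<sigma> \<eta> \<notin> cube N \<Longrightarrow> c \<eta> \<sigma> = 0"
    and c_Down_boundary: "\<eta> $ i = 0 \<Longrightarrow> c \<eta> (Down i) = 0"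
    and c_Up_pos: "act (Up i) \<eta> \<in> cube N \<Longrightarrow> c \<eta> (Up i) > 0"
    and detailed_balance: "m \<eta> * c \<eta> (Up i) = m (act (Up i) \<eta>) * c (act (Up i) \<eta>) (Down i)"
    and c_Up_commute: "c \<eta> (Up i) * c (act (Up i) \<eta>) (Up j) = c \<eta> (Up j) * c (act (Up j) \<eta>) (Up i)"
    and kappa_plus_nonneg: "act (Up i) \<eta> \<in> cube N \<Longrightarrow> kappa_plus c \<eta> i \<ge> 0"
    and kappa_minus_nonneg: "act (Up i) \<eta> \<in> cube N \<Longrightarrow> kappa_minus c \<eta> i \<ge> 0"
    and k_le: "act (Up i) \<eta> \<in> cube N \<Longrightarrow> k \<le> kappa_plus c \<eta> i + kappa_minus c \<eta> i"
    and k_pos: "k > 0"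
begin

definition edge_weight :: "nat ^ 'd \<Rightarrow> 'd \<Rightarrow> real" where
  "edge_weight \<eta> i = m \<eta> * c \<eta> (Up i)"

text \<open>Each undirected edge is counted once, from its lower end point. For symmetric
  \<open>G\<close> this absorbs the factor 1/2 of the sum over all moves.\<close>

definition energy :: "(nat ^ 'd \<Rightarrow> nat ^ 'd \<Rightarrow> real) \<Rightarrow> real" where
  "energy G = (\<Sum>\<eta>\<in>cube N. \<Sum>i\<in>UNIV. edge_weight \<eta> i * G \<eta> (act (Up i) \<eta>))"

lemma edge_weight_nonneg [simp]: "edge_weight \<eta> i \<ge> 0"
  using m_pos[of \<eta>] c_nonneg by (simp add: edge_weight_def)

lemma edge_weight_outside: "act (Up i) \<eta> \<notin> cube N \<Longrightarrow> edge_weight \<eta> i = 0"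
  by (simp add: edge_weight_def c_outside)

lemma edge_weight_Down: "edge_weight \<eta> i = m (act (Up i) \<eta>) * c (act (Up i) \<eta>) (Down i)"
  unfolding edge_weight_def by (rule detailed_balance)

text \<open>Rates of the coupled jumps from the pair \<open>\<eta>\<close>, \<open>act (Up i) \<eta>\<close>: \<open>both\<close> moves both points
  by \<open>\<sigma>\<close>; \<open>upper\<close> moves the second point by \<open>\<sigma>\<close> while the first one jumps to \<open>act (Up i) \<eta>\<close>;
  \<open>lower\<close> moves the first point by \<open>\<sigma>\<close> while the second one jumps to \<open>\<eta>\<close>. What is left of the
  moves \<open>Up i\<close> and \<open>Down i\<close> merges the two points, at rates \<open>kappa_plus\<close> and \<open>kappa_minus\<close>.\<close>

definition both :: "nat ^ 'd \<Rightarrow> 'd \<Rightarrow> 'd move \<Rightarrow> real" where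
  "both \<eta> i \<sigma> = min (c \<eta> \<sigma>) (c (act (Up i) \<eta>) \<sigma>)"

definition upper :: "nat ^ 'd \<Rightarrow> 'd \<Rightarrow> 'd move \<Rightarrow> real" where
  "upper \<eta> i \<sigma> = (if \<sigma> \<in> {Up i, Down i} then 0 else max (c (act (Up i) \<eta>) \<sigma> - c \<eta> \<sigma>) 0)"

definition lower :: "nat ^ 'd \<Rightarrow> 'd \<Rightarrow> 'd move \<Rightarrow> real" where
  "lower \<eta> i \<sigma> = (if \<sigma> \<in> {Up i, Down i} then 0 else max (c \<eta> \<sigma> - c (act (Up i) \<eta>) \<sigma>) 0)"

lemma coupled_rates_nonneg: "both \<eta> i \<sigma> \<ge> 0" "upper \<eta> i \<sigma> \<ge> 0" "lower \<eta> i \<sigma> \<ge> 0"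
  using c_nonneg by (auto simp: both_def upper_def lower_def)

lemma kappa_plus_eq:
  "kappa_plus c \<eta> i = c \<eta> (Up i) - c (act (Up i) \<eta>) (Up i) - (\<Sum>\<sigma>\<in>UNIV. upper \<eta> i \<sigma>)"
proof -
  have "(\<Sum>\<sigma>\<in>UNIV. upper \<eta> i \<sigma>) = (\<Sum>\<sigma>\<in>UNIV - {Up i, Down i}. max (nabla (Up i) (\<lambda>\<zeta>. c \<zeta> \<sigma>) \<eta>) 0)"
    by (rule sum.mono_neutral_cong_right) (auto simp: upper_def nabla_def)
  then show ?thesis by (simp add: kappa_plus_def nabla_def)
qed

lemma kappa_minus_eq:
  "kappa_minus c \<eta> i = c (act (Up i) \<eta>) (Down i) - c \<eta> (Down i) - (\<Sum>\<sigma>\<in>UNIV. lower \<eta> i \<sigma>)"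
proof -
  have "(\<Sum>\<sigma>\<in>UNIV. lower \<eta> i \<sigma>) = (\<Sum>\<sigma>\<in>UNIV - {Up i, Down i}. max (- nabla (Up i) (\<lambda>\<zeta>. c \<zeta> \<sigma>) \<eta>) 0)"
    by (rule sum.mono_neutral_cong_right) (auto simp: lower_def nabla_def)
  then show ?thesis by (simp add: kappa_minus_def nabla_def)
qed

lemma c_Up_antimono: "act (Up i) \<eta> \<in> cube N \<Longrightarrow> c (act (Up i) \<eta>) (Up i) \<le> c \<eta> (Up i)"
  using kappa_plus_nonneg[of i \<eta>] sum_nonneg[of UNIV "upper \<eta> i"] coupled_rates_nonneg
  by (simp add: kappa_plus_eq)

lemma c_Down_mono: "act (Up i) \<eta> \<in> cube N \<Longrightarrow> c \<eta> (Down i) \<le> c (act (Up i) \<eta>) (Down i)"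
  using kappa_minus_nonneg[of i \<eta>] sum_nonneg[of UNIV "lower \<eta> i"] coupled_rates_nonneg
  by (simp add: kappa_minus_eq)

text \<open>Only \<open>Up i\<close> has an excess rate at the lower end point beyond
  \<open>both\<close> and \<open>lower\<close>. Part of it compensates the jumps of the upper point
  that have no partner, and what remains is the merging rate \<open>kappa_plus\<close>.\<close>

lemma rate_split_first:
  assumes "act (Up i) \<eta> \<in> cube N"
  shows "(\<Sum>\<sigma>\<in>UNIV. c \<eta> \<sigma> * h \<sigma>)
    = (\<Sum>\<sigma>\<in>UNIV. (both \<eta> i \<sigma> + lower \<eta> i \<sigma>) * h \<sigma> + upper \<eta> i \<sigma> * h (Up i)) + kappa_plus c \<eta> i * h (Up i)"
proof -
  have "c \<eta> \<sigma> * h \<sigma> = (both \<eta> i \<sigma> + lower \<eta> i \<sigma>) * h \<sigma>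
      + (if \<sigma> = Up i then (c \<eta> (Up i) - c (act (Up i) \<eta>) (Up i)) * h (Up i) else 0)" for \<sigma>
    using c_Up_antimono[OF assms] c_Down_mono[OF assms]
    by (auto simp: both_def lower_def min_def max_def algebra_simps)
  then have "(\<Sum>\<sigma>\<in>UNIV. c \<eta> \<sigma> * h \<sigma>) = (\<Sum>\<sigma>\<in>UNIV. (both \<eta> i \<sigma> + lower \<eta> i \<sigma>) * h \<sigma>)
      + (c \<eta> (Up i) - c (act (Up i) \<eta>) (Up i)) * h (Up i)"
    by (simp add: sum.distrib)
  then show ?thesis
    by (simp add: kappa_plus_eq sum.distrib sum_distrib_left algebra_simps)
qed

lemma rate_split_second:
  assumes "act (Up i) \<eta> \<in> cube N"
  shows "(\<Sum>\<sigma>\<in>UNIV. c (act (Up i) \<eta>) \<sigma> * h \<sigma>)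
    = (\<Sum>\<sigma>\<in>UNIV. (both \<eta> i \<sigma> + upper \<eta> i \<sigma>) * h \<sigma> + lower \<eta> i \<sigma> * h (Down i)) + kappa_minus c \<eta> i * h (Down i)"
proof -
  have "c (act (Up i) \<eta>) \<sigma> * h \<sigma> = (both \<eta> i \<sigma> + upper \<eta> i \<sigma>) * h \<sigma>
      + (if \<sigma> = Down i then (c (act (Up i) \<eta>) (Down i) - c \<eta> (Down i)) * h (Down i) else 0)" for \<sigma>
    using c_Up_antimono[OF assms] c_Down_mono[OF assms]
    by (auto simp: both_def upper_def min_def max_def algebra_simps)
  then have "(\<Sum>\<sigma>\<in>UNIV. c (act (Up i) \<eta>) \<sigma> * h \<sigma>) = (\<Sum>\<sigma>\<in>UNIV. (both \<eta> i \<sigma> + upper \<eta> i \<sigma>) * h \<sigma>)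
      + (c (act (Up i) \<eta>) (Down i) - c \<eta> (Down i)) * h (Down i)"
    by (simp add: sum.distrib)
  then show ?thesis
    by (simp add: kappa_minus_eq sum.distrib sum_distrib_left algebra_simps)
qed

text \<open>The mean change of \<open>G\<close> caused by the coupled jumps labelled \<sigma>, with
  the merging jumps left out.\<close>

definition flux :: "(nat ^ 'd \<Rightarrow> nat ^ 'd \<Rightarrow> real) \<Rightarrow> nat ^ 'd \<Rightarrow> 'd \<Rightarrow> 'd move \<Rightarrow> real" where
  "flux G \<eta> i \<sigma> =
     both \<eta> i \<sigma> * (G (act \<sigma> \<eta>) (act \<sigma> (act (Up i) \<eta>)) - G \<eta> (act (Up i) \<eta>))
     + upper \<eta> i \<sigma> * (G (act (Up i) \<eta>) (act \<sigma> (act (Up i) \<eta>)) - G \<eta> (act (Up i) \<eta>))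
     + lower \<eta> i \<sigma> * (G (act \<sigma> \<eta>) \<eta> - G \<eta> (act (Up i) \<eta>))"

text \<open>The change from an edge to the parallel edge of a square, weighted by the two-step
  upward path. The flux of a single ordered pair i, j does not reduce to this; only the sum over
  both orders does.\<close>

definition flux_Up :: "(nat ^ 'd \<Rightarrow> nat ^ 'd \<Rightarrow> real) \<Rightarrow> nat ^ 'd \<Rightarrow> 'd \<Rightarrow> 'd \<Rightarrow> real" where
  "flux_Up G \<eta> i j = edge_weight \<eta> i * c (act (Up i) \<eta>) (Up j)
     * (G (act (Up j) \<eta>) (act (Up j) (act (Up i) \<eta>)) - G \<eta> (act (Up i) \<eta>))"

end

section \<open>Cancellation of the transport terms around lattice squares\<close>

lemma double_sum_cong_sym:
  fixes X Y :: "'a::finite \<Rightarrow> 'a \<Rightarrow> real"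
  assumes "\<And>i j. X i j + X j i = Y i j + Y j i"
  shows "(\<Sum>i\<in>UNIV. \<Sum>j\<in>UNIV. X i j) = (\<Sum>i\<in>UNIV. \<Sum>j\<in>UNIV. Y i j)"
proof -
  have *: "2 * (\<Sum>i\<in>UNIV. \<Sum>j\<in>UNIV. Z i j) = (\<Sum>i\<in>UNIV. \<Sum>j\<in>UNIV. Z i j + Z j i)"
    for Z :: "'a \<Rightarrow> 'a \<Rightarrow> real"
    using sum.swap[of Z UNIV UNIV] by (simp add: sum.distrib)
  show ?thesis using *[of X] *[of Y] assms by simp
qed

text \<open>\<open>P1\<close>, \<open>P2\<close> are the two sides of a lattice square at one corner and \<open>P3\<close>, \<open>P4\<close> the sides
  parallel to them.\<close>

lemma square_identity:
  fixes S T P1 P2 P3 P4 :: real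
  shows "min S T * (P3 - P1) + max (T - S) 0 * (P4 - P1) + max (S - T) 0 * (P2 - P1)
    + (min S T * (P4 - P2) + max (T - S) 0 * (P3 - P2) + max (S - T) 0 * (P1 - P2))
    = T * (P3 - P1) + T * (P4 - P2)"
  by (cases "S \<le> T") (auto simp: min_def max_def algebra_simps)

lemma mult_min_max_diff:
  fixes w :: real
  assumes "w \<ge> 0"
  shows "w * (min x y * A + max (y - x) 0 * B + max (x - y) 0 * C)
    = min (w * x) (w * y) * A + max (w * y - w * x) 0 * B + max (w * x - w * y) 0 * C"
proof -
  have "w * min x y = min (w * x) (w * y)" "w * max (y - x) 0 = max (w * y - w * x) 0"
    "w * max (x - y) 0 = max (w * x - w * y) 0"
    using assms by (auto simp: min_mult_distrib_left max_mult_distrib_left right_diff_distrib)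
  then show ?thesis by (simp add: distrib_left mult.assoc[symmetric])
qed

context cube_chain
begin

text \<open>The two edges leave the same lower corner of a square. After multiplication by the edge
  weights their coupled rates become one common pair S, T: S is symmetric in i and j by its form, T
  by \<open>c_Up_commute\<close>.\<close>

lemma flux_Up_square:
  assumes sym: "\<And>x y. G x y = G y x"
  shows "edge_weight \<eta> i * flux G \<eta> i (Up j) + edge_weight \<eta> j * flux G \<eta> j (Up i)
    = flux_Up G \<eta> i j + flux_Up G \<eta> j i"
proof (cases "i = j")
  case True
  then show ?thesis
    using c_Up_antimono[of i \<eta>] edge_weight_outside[of i \<eta>]
    by (cases "act (Up i) \<eta> \<in> cube N") (auto simp: flux_def flux_Up_def both_def upper_def lower_def min_def)
next
  case False
  define S where "S = edge_weight \<eta> i * c \<eta> (Up j)"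
  define T where "T = edge_weight \<eta> i * c (act (Up i) \<eta>) (Up j)"
  have S': "S = edge_weight \<eta> j * c \<eta> (Up i)" by (simp add: S_def edge_weight_def)
  have T': "T = edge_weight \<eta> j * c (act (Up j) \<eta>) (Up i)"
    using c_Up_commute[of \<eta> i j] by (simp add: T_def edge_weight_def mult.assoc)
  have 1: "edge_weight \<eta> i * flux G \<eta> i (Up j) =
      min S T * (G (act (Up j) \<eta>) (act (Up j) (act (Up i) \<eta>)) - G \<eta> (act (Up i) \<eta>))
      + max (T - S) 0 * (G (act (Up i) \<eta>) (act (Up j) (act (Up i) \<eta>)) - G \<eta> (act (Up i) \<eta>))
      + max (S - T) 0 * (G \<eta> (act (Up j) \<eta>) - G \<eta> (act (Up i) \<eta>))"
    using False mult_min_max_diff[of "edge_weight \<eta> i" "c \<eta> (Up j)" "c (act (Up i) \<eta>) (Up j)"] sym[of "act (Up j) \<eta>" \<eta>]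
    by (simp add: flux_def both_def upper_def lower_def S_def T_def)
  have 2: "edge_weight \<eta> j * flux G \<eta> j (Up i) =
      min S T * (G (act (Up i) \<eta>) (act (Up j) (act (Up i) \<eta>)) - G \<eta> (act (Up j) \<eta>))
      + max (T - S) 0 * (G (act (Up j) \<eta>) (act (Up j) (act (Up i) \<eta>)) - G \<eta> (act (Up j) \<eta>))
      + max (S - T) 0 * (G \<eta> (act (Up i) \<eta>) - G \<eta> (act (Up j) \<eta>))"
    using False mult_min_max_diff[of "edge_weight \<eta> j" "c \<eta> (Up i)" "c (act (Up j) \<eta>) (Up i)"] sym[of "act (Up i) \<eta>" \<eta>]
    by (simp add: flux_def both_def upper_def lower_def S' T' act_Up_commute[of j i])
  have 3: "flux_Up G \<eta> i j = T * (G (act (Up j) \<eta>) (act (Up j) (act (Up i) \<eta>)) - G \<eta> (act (Up i) \<eta>))"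
    by (simp add: flux_Up_def T_def)
  have 4: "flux_Up G \<eta> j i = T * (G (act (Up i) \<eta>) (act (Up j) (act (Up i) \<eta>)) - G \<eta> (act (Up j) \<eta>))"
    by (simp add: flux_Up_def T' act_Up_commute[of i j])
  show ?thesis unfolding 1 2 3 4 by (rule square_identity)
qed

text \<open>The same square seen from its upper corner: detailed balance reads T downwards, and D
  takes the part of S. The transport comes out as that of the upward jumps with the opposite
  sign.\<close>

lemma flux_Down_square:
  assumes sym: "\<And>x y. G x y = G y x"
  shows "edge_weight (act (Up j) \<zeta>) i * flux G (act (Up j) \<zeta>) i (Down j)
      + edge_weight (act (Up i) \<zeta>) j * flux G (act (Up i) \<zeta>) j (Down i)
    = - flux_Up G \<zeta> i j + - flux_Up G \<zeta> j i"
proof -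
  define T where "T = edge_weight \<zeta> i * c (act (Up i) \<zeta>) (Up j)"
  have T1: "T = edge_weight (act (Up j) \<zeta>) i * c (act (Up j) \<zeta>) (Down j)"
  proof -
    have "T = m \<zeta> * (c \<zeta> (Up i) * c (act (Up i) \<zeta>) (Up j))" by (simp add: T_def edge_weight_def)
    also have "\<dots> = (m \<zeta> * c \<zeta> (Up j)) * c (act (Up j) \<zeta>) (Up i)" by (simp add: c_Up_commute)
    finally show ?thesis unfolding detailed_balance by (simp add: edge_weight_def)
  qed
  have T2: "T = edge_weight (act (Up i) \<zeta>) j * c (act (Up i) \<zeta>) (Down i)"
    unfolding T_def by (simp add: edge_weight_def detailed_balance)
  have D1: "act (Down j) (act (Up i) (act (Up j) \<zeta>)) = act (Up i) \<zeta>"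
    by (simp add: act_Up_commute[of i j])
  show ?thesis
  proof (cases "i = j")
    case True
    then have "edge_weight (act (Up i) \<zeta>) i * flux G (act (Up i) \<zeta>) i (Down i) = - flux_Up G \<zeta> i i"
      using c_Down_mono[of i "act (Up i) \<zeta>"] edge_weight_outside[of i "act (Up i) \<zeta>"] T2
      by (cases "act (Up i) (act (Up i) \<zeta>) \<in> cube N")
        (auto simp: flux_def flux_Up_def both_def upper_def lower_def T_def min_def algebra_simps)
    then show ?thesis using True by simp
  next
    case False
    define D where "D = edge_weight (act (Up j) \<zeta>) i * c (act (Up i) (act (Up j) \<zeta>)) (Down j)"
    \<comment> \<open>By detailed balance D is the mass of the upper corner times its two downward
      rates, hence symmetric in i and j.\<close>
    have D': "D = edge_weight (act (Up i) \<zeta>) j * c (act (Up i) (act (Up j) \<zeta>)) (Down i)"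
      by (simp add: D_def edge_weight_Down act_Up_commute[of i j])
    define P1 where "P1 = G \<zeta> (act (Up i) \<zeta>)"
    define P2 where "P2 = G \<zeta> (act (Up j) \<zeta>)"
    define P3 where "P3 = G (act (Up j) \<zeta>) (act (Up i) (act (Up j) \<zeta>))"
    define P4 where "P4 = G (act (Up i) \<zeta>) (act (Up i) (act (Up j) \<zeta>))"
    have 1: "edge_weight (act (Up j) \<zeta>) i * flux G (act (Up j) \<zeta>) i (Down j) =
        min T D * (P1 - P3) + max (D - T) 0 * (P4 - P3) + max (T - D) 0 * (P2 - P3)"
      using False mult_min_max_diff[of "edge_weight (act (Up j) \<zeta>) i"
          "c (act (Up j) \<zeta>) (Down j)" "c (act (Up i) (act (Up j) \<zeta>)) (Down j)"]
        sym[of "act (Up i) (act (Up j) \<zeta>)" "act (Up i) \<zeta>"]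
      by (simp add: flux_def both_def upper_def lower_def T1 D_def P1_def P2_def P3_def P4_def D1)
    have 2: "edge_weight (act (Up i) \<zeta>) j * flux G (act (Up i) \<zeta>) j (Down i) =
        min T D * (P2 - P4) + max (D - T) 0 * (P3 - P4) + max (T - D) 0 * (P1 - P4)"
      using False mult_min_max_diff[of "edge_weight (act (Up i) \<zeta>) j"
          "c (act (Up i) \<zeta>) (Down i)" "c (act (Up i) (act (Up j) \<zeta>)) (Down i)"]
        sym[of "act (Up i) (act (Up j) \<zeta>)" "act (Up j) \<zeta>"]
      by (simp add: flux_def both_def upper_def lower_def T2 D' P1_def P2_def P3_def P4_def
          act_Up_commute[of j i])
    have 3: "flux_Up G \<zeta> i j = T * (P3 - P1)"
      by (simp add: flux_Up_def T_def P1_def P3_def act_Up_commute[of j i])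
    have T3: "T = edge_weight \<zeta> j * c (act (Up j) \<zeta>) (Up i)"
      using c_Up_commute[of \<zeta> i j] by (simp add: T_def edge_weight_def mult.assoc)
    have 4: "flux_Up G \<zeta> j i = T * (P4 - P2)"
      by (simp add: flux_Up_def T3 P2_def P4_def)
    \<comment> \<open>The instantiation follows the order of occurrence in the identity, so P1 is
      exchanged with P3 and P2 with P4: the sides at the corner are now those at the top.\<close>
    show ?thesis using square_identity[of D T P1 P3 P2 P4] unfolding 1 2 3 4
      by (simp add: min.commute algebra_simps)
  qed
qed

lemma flux_Down_boundary: "\<eta> $ j = 0 \<Longrightarrow> flux G \<eta> i (Down j) = 0"
  using c_nonneg[of "act (Up i) \<eta>" "Down j"]
  by (cases "i = j")
    (auto simp: flux_def both_def upper_def lower_def c_Down_boundary act_Up_nth)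

lemma sum_flux_eq_0:
  assumes sym: "\<And>x y. G x y = G y x"
  shows "(\<Sum>\<eta>\<in>cube N. \<Sum>i\<in>UNIV. edge_weight \<eta> i * (\<Sum>\<sigma>\<in>UNIV. flux G \<eta> i \<sigma>)) = 0"
proof -
  define XD where "XD = (\<lambda>\<eta> i j. edge_weight \<eta> i * flux G \<eta> i (Down j))"
  have up: "(\<Sum>i\<in>UNIV. \<Sum>j\<in>UNIV. edge_weight \<eta> i * flux G \<eta> i (Up j))
      = (\<Sum>i\<in>UNIV. \<Sum>j\<in>UNIV. flux_Up G \<eta> i j)" for \<eta>
    by (rule double_sum_cong_sym) (rule flux_Up_square[OF sym])
  have down: "(\<Sum>i\<in>UNIV. \<Sum>j\<in>UNIV. XD (act (Up j) \<eta>) i j)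
      = (\<Sum>i\<in>UNIV. \<Sum>j\<in>UNIV. - flux_Up G \<eta> i j)" for \<eta>
    unfolding XD_def by (rule double_sum_cong_sym) (rule flux_Down_square[OF sym])
  \<comment> \<open>Downward jumps are re-indexed by the lower corner of their square. The terms
    dropped or added vanish: the flux is 0 where coordinate j is 0, and the edge weight is 0 where
    the shifted edge leaves the cube.\<close>
  have shift: "(\<Sum>\<eta>\<in>cube N. XD \<eta> i j) = (\<Sum>\<eta>\<in>cube N. XD (act (Up j) \<eta>) i j)" for i j
  proof -
    have "(\<Sum>\<eta>\<in>cube N. XD \<eta> i j) = (\<Sum>\<eta> | \<eta> \<in> cube N \<and> \<eta> $ j > 0. XD \<eta> i j)"
      by (rule sum.mono_neutral_right) (auto simp: XD_def flux_Down_boundary)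
    also have "\<dots> = (\<Sum>\<eta> | \<eta> \<in> cube N \<and> \<eta> $ j < N. XD (act (Up j) \<eta>) i j)"
      by (rule sum_cube_shift)
    also have "\<dots> = (\<Sum>\<eta>\<in>cube N. XD (act (Up j) \<eta>) i j)"
      by (rule sum.mono_neutral_left)
        (auto simp: XD_def act_Up_in_cube intro!: edge_weight_outside)
    finally show ?thesis .
  qed
  have swap: "(\<Sum>\<eta>\<in>cube N. \<Sum>i\<in>UNIV. \<Sum>j\<in>UNIV. Z \<eta> i j) = (\<Sum>i\<in>UNIV. \<Sum>j\<in>UNIV. \<Sum>\<eta>\<in>cube N. Z \<eta> i j)"
    for Z :: "nat ^ 'd \<Rightarrow> 'd \<Rightarrow> 'd \<Rightarrow> real"
    by (subst sum.swap) (intro sum.cong refl sum.swap)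
  have "(\<Sum>\<eta>\<in>cube N. \<Sum>i\<in>UNIV. edge_weight \<eta> i * (\<Sum>\<sigma>\<in>UNIV. flux G \<eta> i \<sigma>))
      = (\<Sum>\<eta>\<in>cube N. \<Sum>i\<in>UNIV. \<Sum>j\<in>UNIV. edge_weight \<eta> i * flux G \<eta> i (Up j))
        + (\<Sum>\<eta>\<in>cube N. \<Sum>i\<in>UNIV. \<Sum>j\<in>UNIV. XD \<eta> i j)"
    by (simp add: sum_UNIV_move distrib_left sum_distrib_left sum.distrib XD_def)
  also have "(\<Sum>\<eta>\<in>cube N. \<Sum>i\<in>UNIV. \<Sum>j\<in>UNIV. XD \<eta> i j)
      = (\<Sum>\<eta>\<in>cube N. \<Sum>i\<in>UNIV. \<Sum>j\<in>UNIV. XD (act (Up j) \<eta>) i j)"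
    unfolding swap shift ..
  finally show ?thesis by (simp add: up down sum_negf)
qed

definition step :: "real \<Rightarrow> (nat ^ 'd \<Rightarrow> real) \<Rightarrow> nat ^ 'd \<Rightarrow> real" where
  "step \<epsilon> f \<eta> = f \<eta> + \<epsilon> * generator c f \<eta>"

lemma energy_step_le:
  assumes \<Psi>: "edge_convex \<beta> \<Psi>" and \<beta>: "\<beta> \<ge> 1" and f: "\<And>\<eta>. f \<eta> > 0"
    and M: "\<And>\<eta>. (\<Sum>\<sigma>\<in>UNIV. c \<eta> \<sigma>) \<le> M" and \<epsilon>: "\<epsilon> > 0" "\<epsilon> * (2 * M) < 1"
  shows "energy (\<lambda>x y. \<Psi> (step \<epsilon> f x) (step \<epsilon> f y))
    \<le> (1 - \<epsilon> * k * (1 + (\<beta> - 1) * (1 - \<epsilon> * (2 * M)))) * energy (\<lambda>x y. \<Psi> (f x) (f y))"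
proof -
  define G where "G = (\<lambda>x y. \<Psi> (f x) (f y))"
  define g where "g = 1 + (\<beta> - 1) * (1 - \<epsilon> * (2 * M))"
  have G: "G x y = G y x" "G x y \<ge> 0" for x y
    using \<Psi> f by (auto simp: G_def edge_convex_def)
  have g: "g \<ge> 0" using \<beta> \<epsilon> unfolding g_def by (intro add_nonneg_nonneg mult_nonneg_nonneg) auto
  have edge: "edge_weight \<eta> i * \<Psi> (step \<epsilon> f \<eta>) (step \<epsilon> f (act (Up i) \<eta>))
      \<le> (1 - \<epsilon> * k * g) * (edge_weight \<eta> i * G \<eta> (act (Up i) \<eta>))
        + \<epsilon> * (edge_weight \<eta> i * (\<Sum>\<sigma>\<in>UNIV. flux G \<eta> i \<sigma>))" for \<eta> i
  proof (cases "act (Up i) \<eta> \<in> cube N")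
    case True
    define \<eta>' where "\<eta>' = act (Up i) \<eta>"
    define K where "K = kappa_plus c \<eta> i + kappa_minus c \<eta> i"
    have fst: "step \<epsilon> f \<eta> = f \<eta> + \<epsilon> * ((\<Sum>\<sigma>\<in>UNIV. (both \<eta> i \<sigma> + lower \<eta> i \<sigma>) * (f (act \<sigma> \<eta>) - f \<eta>)
        + upper \<eta> i \<sigma> * (f \<eta>' - f \<eta>)) + kappa_plus c \<eta> i * (f \<eta>' - f \<eta>))"
      unfolding step_def generator_eq_sum_moves rate_split_first[OF True] by (simp add: nabla_def \<eta>'_def)
    have snd: "step \<epsilon> f \<eta>' = f \<eta>' + \<epsilon> * ((\<Sum>\<sigma>\<in>UNIV. (both \<eta> i \<sigma> + upper \<eta> i \<sigma>) * (f (act \<sigma> \<eta>') - f \<eta>')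
        + lower \<eta> i \<sigma> * (f \<eta> - f \<eta>')) + kappa_minus c \<eta> i * (f \<eta> - f \<eta>'))"
      unfolding step_def generator_eq_sum_moves \<eta>'_def rate_split_second[OF True] by (simp add: nabla_def)
    \<comment> \<open>Applied to the constant function 1, the two splittings give the total exit
      rates of the end points. Their sum dominates the total coupling rate, hence the bound 2 *
      M.\<close>
    have tot: "(\<Sum>\<sigma>\<in>UNIV. both \<eta> i \<sigma> + upper \<eta> i \<sigma> + lower \<eta> i \<sigma>) + kappa_plus c \<eta> i + kappa_minus c \<eta> i \<le> 2 * M"
    proof -
      have "0 \<le> (\<Sum>\<sigma>\<in>UNIV. both \<eta> i \<sigma> + upper \<eta> i \<sigma> + lower \<eta> i \<sigma>)"
        using coupled_rates_nonneg by (intro sum_nonneg add_nonneg_nonneg) auto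
      then show ?thesis
        using M[of \<eta>] M[of \<eta>'] rate_split_first[OF True, of "\<lambda>_. 1"] rate_split_second[OF True, of "\<lambda>_. 1"]
        by (simp add: \<eta>'_def sum.distrib)
    qed
    have "\<Psi> (step \<epsilon> f \<eta>) (step \<epsilon> f \<eta>') \<le> (1 - \<epsilon> * K * g) * G \<eta> \<eta>' + \<epsilon> * (\<Sum>\<sigma>\<in>UNIV. flux G \<eta> i \<sigma>)"
      unfolding fst snd K_def g_def G_def flux_def \<eta>'_def[symmetric]
      by (rule edge_convex_coupling_step[OF \<Psi> \<beta>])
        (use f kappa_plus_nonneg[OF True] kappa_minus_nonneg[OF True] coupled_rates_nonneg tot \<epsilon> in auto)
    also have "(1 - \<epsilon> * K * g) * G \<eta> \<eta>' \<le> (1 - \<epsilon> * k * g) * G \<eta> \<eta>'"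
      using k_le[OF True] \<epsilon> g G(2) by (intro mult_right_mono diff_left_mono mult_left_mono) (auto simp: K_def)
    finally have "edge_weight \<eta> i * \<Psi> (step \<epsilon> f \<eta>) (step \<epsilon> f \<eta>')
        \<le> edge_weight \<eta> i * ((1 - \<epsilon> * k * g) * G \<eta> \<eta>' + \<epsilon> * (\<Sum>\<sigma>\<in>UNIV. flux G \<eta> i \<sigma>))"
      by (simp add: mult_left_mono)
    then show ?thesis by (simp add: \<eta>'_def algebra_simps)
  qed (simp add: edge_weight_outside)
  have "energy (\<lambda>x y. \<Psi> (step \<epsilon> f x) (step \<epsilon> f y)) \<le>
      (\<Sum>\<eta>\<in>cube N. \<Sum>i\<in>UNIV. (1 - \<epsilon> * k * g) * (edge_weight \<eta> i * G \<eta> (act (Up i) \<eta>))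
        + \<epsilon> * (edge_weight \<eta> i * (\<Sum>\<sigma>\<in>UNIV. flux G \<eta> i \<sigma>)))"
    unfolding energy_def by (intro sum_mono edge)
  also have "\<dots> = (1 - \<epsilon> * k * g) * energy G
      + \<epsilon> * (\<Sum>\<eta>\<in>cube N. \<Sum>i\<in>UNIV. edge_weight \<eta> i * (\<Sum>\<sigma>\<in>UNIV. flux G \<eta> i \<sigma>))"
    by (simp add: energy_def sum.distrib sum_distrib_left)
  finally show ?thesis unfolding sum_flux_eq_0[OF G(1)] by (simp add: G_def g_def)
qed

end

section \<open>Entropy decay along the iterates\<close>

context cube_chain
begin

lemma sum_Down_shift:
  "(\<Sum>\<eta>\<in>cube N. m \<eta> * c \<eta> (Down i) * h \<eta>) = (\<Sum>\<eta>\<in>cube N. edge_weight \<eta> i * h (act (Up i) \<eta>))"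
proof -
  have "(\<Sum>\<eta>\<in>cube N. m \<eta> * c \<eta> (Down i) * h \<eta>)
      = (\<Sum>\<eta> | \<eta> \<in> cube N \<and> \<eta> $ i > 0. m \<eta> * c \<eta> (Down i) * h \<eta>)"
    by (rule sum.mono_neutral_right) (auto simp: c_Down_boundary)
  also have "\<dots> = (\<Sum>\<eta> | \<eta> \<in> cube N \<and> \<eta> $ i < N. edge_weight \<eta> i * h (act (Up i) \<eta>))"
    unfolding sum_cube_shift edge_weight_Down ..
  also have "\<dots> = (\<Sum>\<eta>\<in>cube N. edge_weight \<eta> i * h (act (Up i) \<eta>))"
    by (rule sum.mono_neutral_left) (auto simp: act_Up_in_cube intro!: edge_weight_outside)
  finally show ?thesis .
qed

text \<open>Summation by parts: shifting the downward terms to the lower end point of their edge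
  pairs each edge with its reversal.\<close>

lemma dirichlet_form:
  "(\<Sum>\<eta>\<in>cube N. m \<eta> * (g \<eta> * generator c f \<eta>)) = - energy (\<lambda>x y. (g y - g x) * (f y - f x))"
proof -
  have "m \<eta> * (g \<eta> * generator c f \<eta>) =
      (\<Sum>i\<in>UNIV. edge_weight \<eta> i * (g \<eta> * (f (act (Up i) \<eta>) - f \<eta>)))
      + (\<Sum>i\<in>UNIV. m \<eta> * c \<eta> (Down i) * (g \<eta> * (f (act (Down i) \<eta>) - f \<eta>)))" for \<eta>
    by (simp add: generator_def nabla_def edge_weight_def sum_distrib_left sum.distrib[symmetric] algebra_simps)
  then have "(\<Sum>\<eta>\<in>cube N. m \<eta> * (g \<eta> * generator c f \<eta>)) =
      (\<Sum>\<eta>\<in>cube N. \<Sum>i\<in>UNIV. edge_weight \<eta> i * (g \<eta> * (f (act (Up i) \<eta>) - f \<eta>)))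
      + (\<Sum>i\<in>UNIV. \<Sum>\<eta>\<in>cube N. m \<eta> * c \<eta> (Down i) * (g \<eta> * (f (act (Down i) \<eta>) - f \<eta>)))"
    by (simp add: sum.distrib sum.swap[of _ UNIV])
  also have "(\<Sum>i\<in>UNIV. \<Sum>\<eta>\<in>cube N. m \<eta> * c \<eta> (Down i) * (g \<eta> * (f (act (Down i) \<eta>) - f \<eta>)))
      = (\<Sum>\<eta>\<in>cube N. \<Sum>i\<in>UNIV. edge_weight \<eta> i * (g (act (Up i) \<eta>) * (f \<eta> - f (act (Up i) \<eta>))))"
    by (simp add: sum_Down_shift sum.swap[of _ UNIV])
  also have "(\<Sum>\<eta>\<in>cube N. \<Sum>i\<in>UNIV. edge_weight \<eta> i * (g \<eta> * (f (act (Up i) \<eta>) - f \<eta>))) + \<dots>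
      = (\<Sum>\<eta>\<in>cube N. \<Sum>i\<in>UNIV. - (edge_weight \<eta> i * ((g (act (Up i) \<eta>) - g \<eta>) * (f (act (Up i) \<eta>) - f \<eta>))))"
    unfolding sum.distrib[symmetric] by (intro sum.cong refl) (simp add: algebra_simps)
  finally show ?thesis by (simp add: energy_def sum_negf)
qed

lemma step_pos:
  assumes f: "\<And>\<eta>. f \<eta> > 0" and M: "\<And>\<eta>. (\<Sum>\<sigma>\<in>UNIV. c \<eta> \<sigma>) \<le> M" and \<epsilon>: "\<epsilon> > 0" "\<epsilon> * (2 * M) < 1"
  shows "step \<epsilon> f \<eta> > 0"
proof -
  define s where "s = (\<Sum>\<sigma>\<in>UNIV. c \<eta> \<sigma>)"
  have "s \<ge> 0" unfolding s_def by (intro sum_nonneg c_nonneg)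
  have "\<epsilon> * s \<le> \<epsilon> * M" using M[of \<eta>] \<epsilon> by (simp add: s_def)
  moreover have "\<epsilon> * s \<ge> 0" using \<epsilon> \<open>s \<ge> 0\<close> by simp
  moreover have "2 * (\<epsilon> * M) < 1" using \<epsilon> by (simp add: mult.left_commute)
  ultimately have "\<epsilon> * s < 1" by linarith
  then have "(1 - \<epsilon> * s) * f \<eta> > 0" using f by simp
  moreover have "(\<Sum>\<sigma>\<in>UNIV. c \<eta> \<sigma> * f (act \<sigma> \<eta>)) \<ge> 0"
    by (intro sum_nonneg mult_nonneg_nonneg c_nonneg less_imp_le f)
  moreover have "step \<epsilon> f \<eta> = (1 - \<epsilon> * s) * f \<eta> + \<epsilon> * (\<Sum>\<sigma>\<in>UNIV. c \<eta> \<sigma> * f (act \<sigma> \<eta>))"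
    by (simp add: step_def generator_eq_sum_moves nabla_def s_def sum_subtractf sum_distrib_left algebra_simps)
  ultimately show ?thesis using \<epsilon> by (simp add: add_pos_nonneg)
qed

lemma sum_step: "(\<Sum>\<eta>\<in>cube N. m \<eta> * step \<epsilon> f \<eta>) = (\<Sum>\<eta>\<in>cube N. m \<eta> * f \<eta>)"
proof -
  have "(\<Sum>\<eta>\<in>cube N. m \<eta> * generator c f \<eta>) = 0"
    using dirichlet_form[of "\<lambda>_. 1" f] by (simp add: energy_def)
  then have "\<epsilon> * (\<Sum>\<eta>\<in>cube N. m \<eta> * generator c f \<eta>) = 0" by simp
  then show ?thesis
    by (simp add: step_def distrib_left sum.distrib sum_distrib_left mult.left_commute)
qed

text \<open>The tangent is taken at the old value, so any step that stays positive loses at most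
  \<epsilon> times the energy before it, with no second-order error. In
  \<open>dirichlet_form\<close> the choice of the derivative of \<phi> at f as g produces
  \<open>Phi\<close>.\<close>

lemma entropy_step:
  assumes \<phi>: "convex_on {0<..} \<phi>" "\<And>a. a > 0 \<Longrightarrow> \<phi> differentiable at a"
    and f: "\<And>\<eta>. f \<eta> > 0" and step: "\<And>\<eta>. step \<epsilon> f \<eta> > 0"
  shows "(\<Sum>\<eta>\<in>cube N. m \<eta> * \<phi> (f \<eta>)) - (\<Sum>\<eta>\<in>cube N. m \<eta> * \<phi> (step \<epsilon> f \<eta>))
    \<le> \<epsilon> * energy (\<lambda>x y. Phi \<phi> (f x) (f y))"
proof -
  have "\<phi> (step \<epsilon> f \<eta>) - \<phi> (f \<eta>) \<ge> deriv \<phi> (f \<eta>) * (step \<epsilon> f \<eta> - f \<eta>)" for \<eta>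
    using \<phi>(2)[OF f] f step
    by (intro convex_on_above_tangent_pos[OF \<phi>(1)]) (auto simp: DERIV_deriv_iff_real_differentiable)
  then have "\<phi> (f \<eta>) - \<phi> (step \<epsilon> f \<eta>) \<le> - \<epsilon> * (deriv \<phi> (f \<eta>) * generator c f \<eta>)" for \<eta>
    by (smt (verit) add_diff_cancel_left' mult.left_commute mult_minus_left step_def)
  then have "(\<Sum>\<eta>\<in>cube N. m \<eta> * (\<phi> (f \<eta>) - \<phi> (step \<epsilon> f \<eta>)))
      \<le> (\<Sum>\<eta>\<in>cube N. m \<eta> * (- \<epsilon> * (deriv \<phi> (f \<eta>) * generator c f \<eta>)))"
    by (intro sum_mono mult_left_mono less_imp_le[OF m_pos])
  also have "\<dots> = - \<epsilon> * (\<Sum>\<eta>\<in>cube N. m \<eta> * (deriv \<phi> (f \<eta>) * generator c f \<eta>))"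
    by (simp add: sum_distrib_left mult.left_commute)
  finally show ?thesis
    unfolding dirichlet_form Phi_def by (simp add: sum_subtractf right_diff_distrib)
qed

lemma energy_nonneg: "(\<And>x y. G x y \<ge> 0) \<Longrightarrow> energy G \<ge> 0"
  unfolding energy_def by (intro sum_nonneg mult_nonneg_nonneg) auto

lemma edge_le_energy:
  assumes "\<And>x y. G x y \<ge> 0"
  shows "edge_weight \<eta> i * G \<eta> (act (Up i) \<eta>) \<le> energy G"
proof (cases "\<eta> \<in> cube N")
  case True
  have "edge_weight \<eta> i * G \<eta> (act (Up i) \<eta>) \<le> (\<Sum>i\<in>UNIV. edge_weight \<eta> i * G \<eta> (act (Up i) \<eta>))"
    by (rule member_le_sum[of i UNIV "\<lambda>i. edge_weight \<eta> i * G \<eta> (act (Up i) \<eta>)"]) (use assms in auto)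
  also have "\<dots> \<le> energy G" unfolding energy_def
    by (rule member_le_sum[of \<eta> "cube N" "\<lambda>\<eta>. \<Sum>i\<in>UNIV. edge_weight \<eta> i * G \<eta> (act (Up i) \<eta>)"])
      (use assms True in \<open>auto intro!: sum_nonneg\<close>)
  finally show ?thesis .
qed (use assms energy_nonneg in \<open>auto simp: edge_weight_outside act_Up_in_cube\<close>)

lemma power_step:
  assumes f: "\<And>\<eta>. f \<eta> > 0" and M: "\<And>\<eta>. (\<Sum>\<sigma>\<in>UNIV. c \<eta> \<sigma>) \<le> M"
    and \<epsilon>: "\<epsilon> > 0" "\<epsilon> * (2 * M) < 1"
  shows "(step \<epsilon> ^^ n) f \<eta> > 0"
    and "(\<Sum>\<eta>\<in>cube N. m \<eta> * (step \<epsilon> ^^ n) f \<eta>) = (\<Sum>\<eta>\<in>cube N. m \<eta> * f \<eta>)"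
    and "\<lbrakk>edge_convex \<beta> \<Psi>; \<beta> \<ge> 1; \<epsilon> * k * (1 + (\<beta> - 1) * (1 - \<epsilon> * (2 * M))) \<le> 1\<rbrakk> \<Longrightarrow>
      energy (\<lambda>x y. \<Psi> ((step \<epsilon> ^^ n) f x) ((step \<epsilon> ^^ n) f y))
      \<le> (1 - \<epsilon> * k * (1 + (\<beta> - 1) * (1 - \<epsilon> * (2 * M)))) ^ n * energy (\<lambda>x y. \<Psi> (f x) (f y))"
proof -
  show pos: "(step \<epsilon> ^^ n) f \<eta> > 0" for n \<eta>
  proof (induction n arbitrary: \<eta>)
    case (Suc n)
    then show ?case by (simp add: step_pos[OF _ M \<epsilon>])
  qed (simp add: f)
  show "(\<Sum>\<eta>\<in>cube N. m \<eta> * (step \<epsilon> ^^ n) f \<eta>) = (\<Sum>\<eta>\<in>cube N. m \<eta> * f \<eta>)"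
    by (induction n) (simp_all add: sum_step)
  assume \<Psi>: "edge_convex \<beta> \<Psi>" "\<beta> \<ge> 1" and r: "\<epsilon> * k * (1 + (\<beta> - 1) * (1 - \<epsilon> * (2 * M))) \<le> 1"
  show "energy (\<lambda>x y. \<Psi> ((step \<epsilon> ^^ n) f x) ((step \<epsilon> ^^ n) f y))
      \<le> (1 - \<epsilon> * k * (1 + (\<beta> - 1) * (1 - \<epsilon> * (2 * M)))) ^ n * energy (\<lambda>x y. \<Psi> (f x) (f y))"
  proof (induction n)
    case (Suc n)
    have "energy (\<lambda>x y. \<Psi> ((step \<epsilon> ^^ Suc n) f x) ((step \<epsilon> ^^ Suc n) f y))
      \<le> (1 - \<epsilon> * k * (1 + (\<beta> - 1) * (1 - \<epsilon> * (2 * M))))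
        * energy (\<lambda>x y. \<Psi> ((step \<epsilon> ^^ n) f x) ((step \<epsilon> ^^ n) f y))"
      unfolding funpow.simps o_apply by (rule energy_step_le[OF \<Psi> pos M \<epsilon>])
    also have "\<dots> \<le> (1 - \<epsilon> * k * (1 + (\<beta> - 1) * (1 - \<epsilon> * (2 * M))))
        * ((1 - \<epsilon> * k * (1 + (\<beta> - 1) * (1 - \<epsilon> * (2 * M)))) ^ n * energy (\<lambda>x y. \<Psi> (f x) (f y)))"
      using r by (intro mult_left_mono Suc.IH) auto
    finally show ?case by (simp add: mult.assoc)
  qed simp
qed

text \<open>The energy of the squared distance decays geometrically, so the increments along the
  edges of the cube vanish in the limit. The conserved total mass identifies the common
  limit.\<close>

lemma power_step_tendsto_mean:
  assumes f: "\<And>\<eta>. f \<eta> > 0" and M: "\<And>\<eta>. (\<Sum>\<sigma>\<in>UNIV. c \<eta> \<sigma>) \<le> M"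
    and \<epsilon>: "\<epsilon> > 0" "\<epsilon> * (2 * M) < 1" "\<epsilon> * k < 1" and \<eta>: "\<eta> \<in> cube N"
  shows "(\<lambda>n. (step \<epsilon> ^^ n) f \<eta>) \<longlonglongrightarrow> (\<Sum>\<eta>\<in>cube N. m \<eta> * f \<eta>) / (\<Sum>\<eta>\<in>cube N. m \<eta>)"
proof -
  define F where "F = (\<lambda>n. (step \<epsilon> ^^ n) f)"
  define E where "E = energy (\<lambda>x y. (f y - f x)\<^sup>2)"
  have "(\<lambda>n. (1 - \<epsilon> * k) ^ n) \<longlonglongrightarrow> 0"
    using \<epsilon> k_pos by (intro LIMSEQ_power_zero) simp
  then have null: "(\<lambda>n. (1 - \<epsilon> * k) ^ n * E / w) \<longlonglongrightarrow> 0" for w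
    by (intro tendsto_divide_zero tendsto_mult_left_zero)
  have edge: "(\<lambda>n. F n (act (Up i) \<eta>) - F n \<eta>) \<longlonglongrightarrow> 0" if e: "act (Up i) \<eta> \<in> cube N" for \<eta> i
  proof -
    have w: "edge_weight \<eta> i > 0" using m_pos c_Up_pos[OF e] by (simp add: edge_weight_def)
    have "edge_weight \<eta> i * (F n (act (Up i) \<eta>) - F n \<eta>)\<^sup>2 \<le> (1 - \<epsilon> * k) ^ n * E" for n
      using power_step(3)[where f = f, OF f M \<epsilon>(1,2) edge_convex_square_dist, of n] \<epsilon>(3)
        edge_le_energy[of "\<lambda>x y. (F n y - F n x)\<^sup>2" \<eta> i]
      by (simp add: F_def E_def)
    then have "(F n (act (Up i) \<eta>) - F n \<eta>)\<^sup>2 \<le> (1 - \<epsilon> * k) ^ n * E / edge_weight \<eta> i" for n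
      using w by (simp add: pos_le_divide_eq mult.commute)
    then have "(\<lambda>n. (F n (act (Up i) \<eta>) - F n \<eta>)\<^sup>2) \<longlonglongrightarrow> 0"
      by (intro tendsto_sandwich[OF _ _ tendsto_const null[of "edge_weight \<eta> i"]]) auto
    then show ?thesis by simp
  qed
  \<comment> \<open>Every point is joined to 0 by upward edges, and the path stays in the cube
    because cubes are closed under removing particles.\<close>
  have base: "\<eta> \<in> cube N \<longrightarrow> (\<lambda>n. F n \<eta> - F n 0) \<longlonglongrightarrow> 0" for \<eta>
  proof (induction \<eta> rule: lattice_induct)
    case (Up \<eta> i)
    show ?case
    proof
      assume e: "act (Up i) \<eta> \<in> cube N"
      then have "(\<lambda>n. F n \<eta> - F n 0) \<longlonglongrightarrow> 0" using Up by (simp add: act_Up_in_cube)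
      from tendsto_add[OF edge[OF e] this] show "(\<lambda>n. F n (act (Up i) \<eta>) - F n 0) \<longlonglongrightarrow> 0" by simp
    qed
  qed simp
  define B where "B = (\<Sum>\<eta>\<in>cube N. m \<eta>)"
  have "B > 0" unfolding B_def using m_pos by (intro sum_pos) auto
  have "(\<lambda>n. \<Sum>\<eta>\<in>cube N. m \<eta> * (F n \<eta> - F n 0)) \<longlonglongrightarrow> (\<Sum>\<eta>\<in>cube N. m \<eta> * 0)"
    using base by (intro tendsto_sum tendsto_mult tendsto_const) auto
  moreover have "(\<Sum>\<eta>\<in>cube N. m \<eta> * (F n \<eta> - F n 0)) = (\<Sum>\<eta>\<in>cube N. m \<eta> * f \<eta>) - B * F n 0" for n
    using power_step(2)[where f = f, OF f M \<epsilon>(1,2), of n]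
    by (simp add: F_def B_def right_diff_distrib sum_subtractf sum_distrib_right)
  ultimately have "(\<lambda>n. (\<Sum>\<eta>\<in>cube N. m \<eta> * f \<eta>) - B * F n 0) \<longlonglongrightarrow> 0" by simp
  then have "(\<lambda>n. ((\<Sum>\<eta>\<in>cube N. m \<eta> * f \<eta>) - ((\<Sum>\<eta>\<in>cube N. m \<eta> * f \<eta>) - B * F n 0)) / B)
      \<longlonglongrightarrow> ((\<Sum>\<eta>\<in>cube N. m \<eta> * f \<eta>) - 0) / B"
    by (intro tendsto_intros) (use \<open>B > 0\<close> in auto)
  then have "(\<lambda>n. F n 0) \<longlonglongrightarrow> (\<Sum>\<eta>\<in>cube N. m \<eta> * f \<eta>) / B" using \<open>B > 0\<close> by simp
  from tendsto_add[OF this base[rule_format, OF \<eta>]] show ?thesis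
    by (simp add: F_def B_def)
qed

lemma entropy_le_energy_step:
  assumes \<phi>: "convex_on {0<..} \<phi>" "\<And>a. a > 0 \<Longrightarrow> \<phi> differentiable at a"
    and \<Psi>: "edge_convex \<beta> (Phi \<phi>)" "\<beta> \<ge> 1"
    and f: "\<And>\<eta>. f \<eta> > 0" and M: "\<And>\<eta>. (\<Sum>\<sigma>\<in>UNIV. c \<eta> \<sigma>) \<le> M"
    and \<epsilon>: "\<epsilon> > 0" "\<epsilon> * (2 * M) < 1" "\<epsilon> * k * \<beta> < 1"
  shows "k * (1 + (\<beta> - 1) * (1 - \<epsilon> * (2 * M))) *
    ((\<Sum>\<eta>\<in>cube N. m \<eta> * \<phi> (f \<eta>))
      - (\<Sum>\<eta>\<in>cube N. m \<eta>) * \<phi> ((\<Sum>\<eta>\<in>cube N. m \<eta> * f \<eta>) / (\<Sum>\<eta>\<in>cube N. m \<eta>)))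
    \<le> energy (\<lambda>x y. Phi \<phi> (f x) (f y))"
proof -
  define F where "F = (\<lambda>n. (step \<epsilon> ^^ n) f)"
  define \<mu> where "\<mu> = (\<Sum>\<eta>\<in>cube N. m \<eta> * f \<eta>) / (\<Sum>\<eta>\<in>cube N. m \<eta>)"
  define H where "H = (\<lambda>n. \<Sum>\<eta>\<in>cube N. m \<eta> * \<phi> (F n \<eta>))"
  define E where "E = (\<lambda>n. energy (\<lambda>x y. Phi \<phi> (F n x) (F n y)))"
  define g where "g = 1 + (\<beta> - 1) * (1 - \<epsilon> * (2 * M))"
  define r where "r = 1 - \<epsilon> * k * g"
  have M0: "M \<ge> 0" using M[of 0] sum_nonneg[of UNIV "c 0"] c_nonneg by fastforce
  have g: "g \<ge> 0" "g \<le> \<beta>" using \<epsilon> \<Psi>(2) M0 mult_left_le[of "1 - \<epsilon> * (2 * M)" "\<beta> - 1"]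
    unfolding g_def by (auto intro!: add_nonneg_nonneg mult_nonneg_nonneg)
  have "\<epsilon> * k * g \<le> \<epsilon> * k * \<beta>" using g \<epsilon> k_pos by (intro mult_left_mono) auto
  then have r: "\<epsilon> * k * g \<le> 1" "r \<ge> 0" using \<epsilon>(3) unfolding r_def by linarith+
  have "\<epsilon> * k * 1 \<le> \<epsilon> * k * \<beta>" using \<Psi>(2) \<epsilon> k_pos by (intro mult_left_mono) auto
  then have \<epsilon>k: "\<epsilon> * k < 1" using \<epsilon>(3) by linarith
  have Fpos: "F n \<eta> > 0" for n \<eta> unfolding F_def by (rule power_step(1)[where f = f, OF f M \<epsilon>(1,2)])
  have E0: "E 0 \<ge> 0" using \<Psi>(1) Fpos unfolding E_def
    by (intro energy_nonneg) (simp add: edge_convex_def)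
  have dH: "H n - H (Suc n) \<le> \<epsilon> * (r ^ n * E 0)" for n
  proof -
    have "H n - H (Suc n) \<le> \<epsilon> * E n"
      using entropy_step[OF \<phi>, of "F n" \<epsilon>] Fpos Fpos[of "Suc n"] by (simp add: H_def E_def F_def)
    also have "\<dots> \<le> \<epsilon> * (r ^ n * E 0)"
      using power_step(3)[where f = f, OF f M \<epsilon>(1,2) \<Psi>, of n] r \<epsilon>
      by (intro mult_left_mono) (auto simp: E_def F_def r_def g_def)
    finally show ?thesis .
  qed
  have "k * g * (H 0 - H n) \<le> E 0" for n
  proof -
    have "H 0 - H n = (\<Sum>j<n. H j - H (Suc j))" by (simp add: sum_lessThan_telescope')
    also have "\<dots> \<le> (\<Sum>j<n. \<epsilon> * (r ^ j * E 0))" by (intro sum_mono dH)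
    finally have "k * g * (H 0 - H n) \<le> k * g * (\<Sum>j<n. \<epsilon> * (r ^ j * E 0))"
      using k_pos g by (intro mult_left_mono) auto
    \<comment> \<open>The product k * g * \<epsilon> is exactly 1 - r, so the step size cancels from
      the geometric series and survives only inside g.\<close>
    also have "\<dots> = (1 - r) * (\<Sum>j<n. r ^ j) * E 0"
      by (simp add: r_def sum_distrib_left sum_distrib_right algebra_simps)
    also have "(1 - r) * (\<Sum>j<n. r ^ j) = 1 - r ^ n"
      by (simp add: one_diff_power_eq)
    also have "(1 - r ^ n) * E 0 \<le> E 0" using r E0 by (simp add: mult_left_le_one_le algebra_simps)
    finally show ?thesis .
  qed
  moreover have "(\<lambda>n. k * g * (H 0 - H n)) \<longlonglongrightarrow> k * g * (H 0 - (\<Sum>\<eta>\<in>cube N. m \<eta> * \<phi> \<mu>))"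
  proof -
    have "\<mu> > 0" unfolding \<mu>_def using m_pos f by (intro divide_pos_pos sum_pos) auto
    then have "isCont \<phi> \<mu>" using \<phi>(2) by (simp add: differentiable_imp_continuous_within)
    then have "(\<lambda>n. \<phi> (F n \<eta>)) \<longlonglongrightarrow> \<phi> \<mu>" if "\<eta> \<in> cube N" for \<eta>
      using power_step_tendsto_mean[where f = f, OF f M \<epsilon>(1,2) \<epsilon>k that] unfolding F_def \<mu>_def
      by (rule isCont_tendsto_compose)
    then show ?thesis unfolding H_def by (intro tendsto_intros) auto
  qed
  ultimately have "k * g * (H 0 - (\<Sum>\<eta>\<in>cube N. m \<eta> * \<phi> \<mu>)) \<le> E 0"
    by (intro LIMSEQ_le_const2) auto
  then show ?thesis by (simp add: H_def E_def F_def g_def \<mu>_def sum_distrib_right)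
qed

text \<open>As \<epsilon> tends to 0 the factor 1 + (\<beta> - 1) * (1 - \<epsilon> * (2 * M)) tends
  to \<beta>, while entropy and energy do not depend on \<epsilon>.\<close>

theorem entropy_le_energy:
  assumes \<phi>: "convex_on {0<..} \<phi>" "\<And>a. a > 0 \<Longrightarrow> \<phi> differentiable at a"
    and \<Psi>: "edge_convex \<beta> (Phi \<phi>)" "\<beta> \<ge> 1"
    and f: "\<And>\<eta>. f \<eta> > 0"
  shows "\<beta> * k *
    ((\<Sum>\<eta>\<in>cube N. m \<eta> * \<phi> (f \<eta>))
      - (\<Sum>\<eta>\<in>cube N. m \<eta>) * \<phi> ((\<Sum>\<eta>\<in>cube N. m \<eta> * f \<eta>) / (\<Sum>\<eta>\<in>cube N. m \<eta>)))
    \<le> energy (\<lambda>x y. Phi \<phi> (f x) (f y))" (is "_ * ?H \<le> ?E")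
proof -
  define M where "M = (\<Sum>\<eta>\<in>cube N. \<Sum>\<sigma>\<in>UNIV. c \<eta> \<sigma>)"
  have M: "(\<Sum>\<sigma>\<in>UNIV. c \<eta> \<sigma>) \<le> M" for \<eta>
  proof (cases "\<eta> \<in> cube N")
    case True
    then show ?thesis unfolding M_def
      by (intro member_le_sum) (auto intro!: sum_nonneg c_nonneg)
  qed (use c_nonneg in \<open>auto simp: c_outside M_def intro!: sum_nonneg\<close>)
  have "((\<lambda>\<epsilon>. \<epsilon> * (2 * M)) \<longlongrightarrow> 0) (at_right 0)" "((\<lambda>\<epsilon>. \<epsilon> * k * \<beta>) \<longlongrightarrow> 0) (at_right 0)"
    by (auto intro!: tendsto_eq_intros)
  then have ev: "\<forall>\<^sub>F \<epsilon> in at_right 0. \<epsilon> * (2 * M) < 1" "\<forall>\<^sub>F \<epsilon> in at_right 0. \<epsilon> * k * \<beta> < 1"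
    by (auto intro: order_tendstoD)
  have lim: "((\<lambda>\<epsilon>. k * (1 + (\<beta> - 1) * (1 - \<epsilon> * (2 * M))) * ?H) \<longlongrightarrow> k * (1 + (\<beta> - 1) * (1 - 0 * (2 * M))) * ?H) (at_right 0)"
    by (intro tendsto_intros)
  have "k * (1 + (\<beta> - 1) * (1 - 0 * (2 * M))) * ?H \<le> ?E"
  proof (rule tendsto_upperbound[OF lim])
    show "\<forall>\<^sub>F \<epsilon> in at_right 0. k * (1 + (\<beta> - 1) * (1 - \<epsilon> * (2 * M))) * ?H \<le> ?E"
      using ev eventually_at_right_less[of "0::real"]
      by eventually_elim (rule entropy_le_energy_step[OF \<phi> \<Psi> f M])
  qed simp
  then show ?thesis by (simp add: mult.commute)
qed

end

section \<open>Truncation to cubes\<close>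

text \<open>Both end points are tested, so a jump and its reversal are suppressed together and
  detailed balance survives.\<close>

definition truncate :: "nat \<Rightarrow> (nat ^ 'd \<Rightarrow> 'd::finite move \<Rightarrow> real) \<Rightarrow> nat ^ 'd \<Rightarrow> 'd move \<Rightarrow> real" where
  "truncate N c \<eta> \<sigma> = (if \<eta> \<in> cube N \<and> act \<sigma> \<eta> \<in> cube N then c \<eta> \<sigma> else 0)"

text \<open>Suppressing the exits from a cube only decreases \<open>Up i\<close> at the upper end point of an edge
  in direction \<open>i\<close>; along other moves both end points of the edge are cut off together.\<close>

lemma truncate_perpendicular:
  assumes edge: "act (Up i) \<eta> \<in> cube N" and \<sigma>: "\<sigma> \<notin> {Up i, Down i}"
  shows "nabla (Up i) (\<lambda>\<zeta>. truncate N c \<zeta> \<sigma>) \<eta> \<in> {nabla (Up i) (\<lambda>\<zeta>. c \<zeta> \<sigma>) \<eta>, 0}"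
proof (cases \<sigma>)
  case (Up j)
  have "act (Up j) (act (Up i) \<eta>) \<in> cube N \<longleftrightarrow> act (Up j) \<eta> \<in> cube N"
    using edge \<sigma> by (auto simp: Up act_Up_in_cube act_Up_nth)
  then show ?thesis using edge by (simp add: nabla_def truncate_def Up act_Up_in_cube)
next
  case (Down j)
  then show ?thesis using edge
    by (simp add: nabla_def truncate_def act_Down_in_cube act_Up_in_cube)
qed

text \<open>At the upper end of the edge the rate of \<open>Up i\<close> may be replaced by 0, which
  lowers its increment because rates are nonnegative; the perpendicular increments are kept or
  become 0.\<close>

lemma kappa_plus_truncate:
  assumes edge: "act (Up i) \<eta> \<in> cube N" and c: "\<And>\<eta> \<sigma>. c \<eta> \<sigma> \<ge> 0"
  shows "kappa_plus c \<eta> i \<le> kappa_plus (truncate N c) \<eta> i"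
proof -
  have "(\<Sum>\<sigma>\<in>UNIV - {Up i, Down i}. max (nabla (Up i) (\<lambda>\<zeta>. truncate N c \<zeta> \<sigma>) \<eta>) 0)
      \<le> (\<Sum>\<sigma>\<in>UNIV - {Up i, Down i}. max (nabla (Up i) (\<lambda>\<zeta>. c \<zeta> \<sigma>) \<eta>) 0)"
  proof (rule sum_mono)
    fix \<sigma> assume "\<sigma> \<in> UNIV - {Up i, Down i}"
    then show "max (nabla (Up i) (\<lambda>\<zeta>. truncate N c \<zeta> \<sigma>) \<eta>) 0 \<le> max (nabla (Up i) (\<lambda>\<zeta>. c \<zeta> \<sigma>) \<eta>) 0"
      using truncate_perpendicular[OF edge, of \<sigma> c] by (auto simp: max_def)
  qed
  moreover have "nabla (Up i) (\<lambda>\<zeta>. truncate N c \<zeta> (Up i)) \<eta> \<le> nabla (Up i) (\<lambda>\<zeta>. c \<zeta> (Up i)) \<eta>"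
    using edge c by (simp add: nabla_def truncate_def act_Up_in_cube)
  ultimately show ?thesis by (simp add: kappa_plus_def)
qed

lemma kappa_minus_truncate:
  assumes edge: "act (Up i) \<eta> \<in> cube N"
  shows "kappa_minus c \<eta> i \<le> kappa_minus (truncate N c) \<eta> i"
proof -
  have "(\<Sum>\<sigma>\<in>UNIV - {Up i, Down i}. max (- nabla (Up i) (\<lambda>\<zeta>. truncate N c \<zeta> \<sigma>) \<eta>) 0)
      \<le> (\<Sum>\<sigma>\<in>UNIV - {Up i, Down i}. max (- nabla (Up i) (\<lambda>\<zeta>. c \<zeta> \<sigma>) \<eta>) 0)"
  proof (rule sum_mono)
    fix \<sigma> assume "\<sigma> \<in> UNIV - {Up i, Down i}"
    then show "max (- nabla (Up i) (\<lambda>\<zeta>. truncate N c \<zeta> \<sigma>) \<eta>) 0 \<le> max (- nabla (Up i) (\<lambda>\<zeta>. c \<zeta> \<sigma>) \<eta>) 0"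
      using truncate_perpendicular[OF edge, of \<sigma> c] by (auto simp: max_def)
  qed
  moreover have "nabla (Up i) (\<lambda>\<zeta>. truncate N c \<zeta> (Down i)) \<eta> = nabla (Up i) (\<lambda>\<zeta>. c \<zeta> (Down i)) \<eta>"
    using edge by (simp add: nabla_def truncate_def act_Up_in_cube act_Down_in_cube)
  ultimately show ?thesis by (simp add: kappa_minus_def)
qed

lemma sum_moves_split:
  fixes g :: "'d::finite move \<Rightarrow> 'a::comm_monoid_add"
  shows "(\<Sum>\<sigma>\<in>UNIV. g \<sigma>) = g (Up i) + (g (Down i) + (\<Sum>\<sigma>\<in>UNIV - {Up i, Down i}. g \<sigma>))"
proof -
  have "sum g UNIV = g (Up i) + sum g (UNIV - {Up i})"
    by (rule sum.remove) auto
  also have "sum g (UNIV - {Up i}) = g (Down i) + sum g (UNIV - {Up i} - {Down i})"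
    by (rule sum.remove) auto
  also have "UNIV - {Up i} - {Down i} = UNIV - {Up i, Down i}" by auto
  finally show ?thesis .
qed

section \<open>Rates with nonnegative curvature\<close>

lemma weight_pos [simp]: "weight Vp Vm \<eta> > 0"
  by (simp add: weight_def)

lemma rate_nonneg [simp]: "rate Vp Vm \<eta> \<sigma> \<ge> 0"
  by (cases \<sigma>) auto

lemma rate_pos_iff: "rate Vp Vm \<eta> \<sigma> > 0 \<longleftrightarrow> (case \<sigma> of Up i \<Rightarrow> True | Down i \<Rightarrow> \<eta> $ i > 0)"
  by (cases \<sigma>) auto

text \<open>Both sides equal exp(- Vp(\<eta> + e_i) - Vm(\<eta>)).\<close>

lemma weight_detailed_balance:
  "weight Vp Vm \<eta> * rate Vp Vm \<eta> (Up i)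
    = weight Vp Vm (act (Up i) \<eta>) * rate Vp Vm (act (Up i) \<eta>) (Down i)"
  by (simp add: weight_def nabla_def act_Up_nth exp_add[symmetric])

text \<open>The upward rates are exponentials of increments of one potential, so the product along a
  path depends only on its end points.\<close>

lemma rate_Up_commute:
  "rate Vp Vm \<eta> (Up i) * rate Vp Vm (act (Up i) \<eta>) (Up j)
    = rate Vp Vm \<eta> (Up j) * rate Vp Vm (act (Up j) \<eta>) (Up i)"
  by (simp add: nabla_def exp_add[symmetric] act_Up_commute[of i j])

locale nonneg_curvature =
  fixes Vp Vm :: "nat ^ 'd::finite \<Rightarrow> real"
  assumes kappa_plus_nonneg: "kappa_plus (rate Vp Vm) \<eta> i \<ge> 0"
    and kappa_minus_nonneg: "kappa_minus (rate Vp Vm) \<eta> i \<ge> 0"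
begin

abbreviation c :: "nat ^ 'd \<Rightarrow> 'd move \<Rightarrow> real" where
  "c \<equiv> rate Vp Vm"

lemma kappa_nonneg: "kappa c \<ge> 0"
  unfolding kappa_def
  by (rule cINF_greatest) (auto intro!: add_nonneg_nonneg kappa_plus_nonneg kappa_minus_nonneg)

lemma kappa_le: "kappa c \<le> kappa_plus c \<eta> i + kappa_minus c \<eta> i"
proof -
  have "bdd_below (range (\<lambda>(\<eta>, i). kappa_plus c \<eta> i + kappa_minus c \<eta> i))"
    by (rule bdd_belowI[of _ 0]) (auto intro!: add_nonneg_nonneg kappa_plus_nonneg kappa_minus_nonneg)
  from cINF_lower[OF this, of "(\<eta>, i)"] show ?thesis by (simp add: kappa_def)
qed

lemma cube_chain_truncate:
  assumes "z > 0" "kappa c > 0"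
  shows "cube_chain (truncate N c) (\<lambda>\<eta>. z * weight Vp Vm \<eta>) N (kappa c)"
proof
  fix \<eta> :: "nat ^ 'd" and i assume edge: "act (Up i) \<eta> \<in> cube N"
  note kp = kappa_plus_truncate[OF edge, of c, OF rate_nonneg]
  note km = kappa_minus_truncate[OF edge, of c]
  show "kappa_plus (truncate N c) \<eta> i \<ge> 0" using kp kappa_plus_nonneg[of \<eta> i] by simp
  show "kappa_minus (truncate N c) \<eta> i \<ge> 0" using km kappa_minus_nonneg[of \<eta> i] by simp
  show "kappa c \<le> kappa_plus (truncate N c) \<eta> i + kappa_minus (truncate N c) \<eta> i"
    using kp km kappa_le[of \<eta> i] by simp
  show "truncate N c \<eta> (Up i) > 0" using edge by (simp add: truncate_def act_Up_in_cube)
next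
  fix \<eta> i
  show "z * weight Vp Vm \<eta> * truncate N c \<eta> (Up i)
      = z * weight Vp Vm (act (Up i) \<eta>) * truncate N c (act (Up i) \<eta>) (Down i)"
    using weight_detailed_balance[of Vp Vm \<eta> i] by (simp add: truncate_def conj_commute)
next
  fix \<eta> i j
  show "truncate N c \<eta> (Up i) * truncate N c (act (Up i) \<eta>) (Up j)
      = truncate N c \<eta> (Up j) * truncate N c (act (Up j) \<eta>) (Up i)"
  proof (cases "act (Up i) (act (Up j) \<eta>) \<in> cube N")
    case True
    then have "act (Up j) (act (Up i) \<eta>) \<in> cube N" by (simp add: act_Up_commute)
    with True show ?thesis using rate_Up_commute[of Vp Vm \<eta> i j]
      by (simp add: truncate_def act_Up_in_cube)
  next
    case False
    then have "act (Up j) (act (Up i) \<eta>) \<notin> cube N" by (simp add: act_Up_commute)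
    with False show ?thesis by (simp add: truncate_def)
  qed
qed (use assms in \<open>auto simp: truncate_def\<close>)

section \<open>Growth of the rates and summability of the weights\<close>

lemma sum_Up_rates_le: "(\<Sum>j\<in>UNIV. c \<eta> (Up j)) \<le> (\<Sum>j\<in>UNIV. c 0 (Up j))"
proof (induction \<eta> rule: lattice_induct)
  case (Up \<eta> i)
  \<comment> \<open>\<open>u\<close> selects the upward moves. By \<open>kappa_plus_nonneg\<close>
    an added particle lowers the rate of \<open>Up i\<close> at least by the total increase of all
    perpendicular rates, so the selected sum cannot grow.\<close>
  define u :: "'d move \<Rightarrow> real" where "u = (\<lambda>\<sigma>. case \<sigma> of Up _ \<Rightarrow> 1 | Down _ \<Rightarrow> 0)"
  define D where "D = (\<lambda>\<sigma>. nabla (Up i) (\<lambda>\<zeta>. c \<zeta> \<sigma>) \<eta>)"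
  have "(\<Sum>j\<in>UNIV. c (act (Up i) \<eta>) (Up j)) - (\<Sum>j\<in>UNIV. c \<eta> (Up j)) = (\<Sum>\<sigma>\<in>UNIV. u \<sigma> * D \<sigma>)"
    by (simp add: sum_UNIV_move u_def D_def nabla_def sum_subtractf del: rate.simps)
  also have "\<dots> = D (Up i) + (\<Sum>\<sigma>\<in>UNIV - {Up i, Down i}. u \<sigma> * D \<sigma>)"
    by (simp add: sum_moves_split[of _ i] u_def)
  also have "(\<Sum>\<sigma>\<in>UNIV - {Up i, Down i}. u \<sigma> * D \<sigma>) \<le> (\<Sum>\<sigma>\<in>UNIV - {Up i, Down i}. max (D \<sigma>) 0)"
    by (intro sum_mono) (auto simp: u_def max_def split: move.split)
  finally show ?case
    using kappa_plus_nonneg[of \<eta> i] Up by (simp add: kappa_plus_def D_def)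
qed simp

text \<open>The generator applied to the total number of particles.\<close>

definition drift :: "nat ^ 'd \<Rightarrow> real" where
  "drift \<eta> = (\<Sum>j\<in>UNIV. c \<eta> (Up j)) - (\<Sum>j\<in>UNIV. c \<eta> (Down j))"

text \<open>A perpendicular rate changes the drift by at most the positive plus the negative part of
  its increment, which is what \<open>kappa_plus\<close> and \<open>kappa_minus\<close> subtract.
  Every added particle therefore costs at least \<open>kappa c\<close>.\<close>

lemma drift_le: "drift \<eta> \<le> drift 0 - kappa c * real (\<Sum>j\<in>UNIV. \<eta> $ j)"
proof (induction \<eta> rule: lattice_induct)
  case (Up \<eta> i)
  define u :: "'d move \<Rightarrow> real" where "u = (\<lambda>\<sigma>. case \<sigma> of Up _ \<Rightarrow> 1 | Down _ \<Rightarrow> -1)"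
  define D where "D = (\<lambda>\<sigma>. nabla (Up i) (\<lambda>\<zeta>. c \<zeta> \<sigma>) \<eta>)"
  have "drift (act (Up i) \<eta>) - drift \<eta> = (\<Sum>\<sigma>\<in>UNIV. u \<sigma> * D \<sigma>)"
    by (simp add: drift_def sum_UNIV_move u_def D_def nabla_def sum_subtractf sum_negf del: rate.simps)
  also have "\<dots> = D (Up i) - D (Down i) + (\<Sum>\<sigma>\<in>UNIV - {Up i, Down i}. u \<sigma> * D \<sigma>)"
    by (simp add: sum_moves_split[of _ i] u_def)
  also have "(\<Sum>\<sigma>\<in>UNIV - {Up i, Down i}. u \<sigma> * D \<sigma>)
      \<le> (\<Sum>\<sigma>\<in>UNIV - {Up i, Down i}. max (D \<sigma>) 0 + max (- D \<sigma>) 0)"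
    by (intro sum_mono) (auto simp: u_def max_def split: move.split)
  finally have "drift (act (Up i) \<eta>) \<le> drift \<eta> - (kappa_plus c \<eta> i + kappa_minus c \<eta> i)"
    by (simp add: kappa_plus_def kappa_minus_def D_def sum.distrib)
  then show ?case using kappa_le[of \<eta> i] Up by (simp add: sum_nth_act_Up algebra_simps)
qed simp

text \<open>Reversibility matches the downward jumps inside the cube with the upward jumps inside
  it; the surplus on the right consists of the jumps that leave the cube.\<close>

lemma sum_cube_Down_le_Up:
  "(\<Sum>\<eta>\<in>cube N. \<Sum>i\<in>UNIV. weight Vp Vm \<eta> * c \<eta> (Down i))
    \<le> (\<Sum>\<eta>\<in>cube N. \<Sum>i\<in>UNIV. weight Vp Vm \<eta> * c \<eta> (Up i))"
proof -
  have "(\<Sum>\<eta>\<in>cube N. weight Vp Vm \<eta> * c \<eta> (Down i)) \<le> (\<Sum>\<eta>\<in>cube N. weight Vp Vm \<eta> * c \<eta> (Up i))" for i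
  proof -
    have "(\<Sum>\<eta>\<in>cube N. weight Vp Vm \<eta> * c \<eta> (Down i))
        = (\<Sum>\<eta> | \<eta> \<in> cube N \<and> \<eta> $ i > 0. weight Vp Vm \<eta> * c \<eta> (Down i))"
      by (rule sum.mono_neutral_right) auto
    also have "\<dots> = (\<Sum>\<eta> | \<eta> \<in> cube N \<and> \<eta> $ i < N. weight Vp Vm \<eta> * c \<eta> (Up i))"
      unfolding sum_cube_shift weight_detailed_balance ..
    also have "\<dots> \<le> (\<Sum>\<eta>\<in>cube N. weight Vp Vm \<eta> * c \<eta> (Up i))"
      by (rule sum_mono2) (auto simp: less_imp_le)
    finally show ?thesis .
  qed
  then show ?thesis by (subst (1 2) sum.swap) (rule sum_mono)
qed

text \<open>The total number of particles is a Lyapunov function: its drift decreases linearly, while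
  by reversibility its mean over a cube is nonnegative.\<close>

lemma weight_summable:
  assumes kappa: "kappa c > 0"
  shows "weight Vp Vm summable_on UNIV"
proof -
  define w where "w = weight Vp Vm"
  define S where "S = drift 0"
  have w: "w \<eta> > 0" for \<eta> by (simp add: w_def)
  have S: "S > 0" unfolding S_def drift_def by (simp add: sum_pos)
  \<comment> \<open>Outside \<open>A\<close> the drift is at most S - 2 * S = - S, and inside it is
    at most S. A nonnegative mean drift then leaves at most half of the mass of a cube outside the
    finite set \<open>A\<close>, whence the factor 2 below.\<close>
  define A where "A = {\<eta> :: nat ^ 'd. kappa c * real (\<Sum>j\<in>UNIV. \<eta> $ j) \<le> 2 * S}"
  have "finite A"
  proof (rule finite_subset)
    show "A \<subseteq> cube (nat \<lfloor>2 * S / kappa c\<rfloor>)"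
    proof
      fix \<eta> assume "\<eta> \<in> A"
      then have "real (\<Sum>j\<in>UNIV. \<eta> $ j) \<le> 2 * S / kappa c"
        using kappa by (simp add: A_def pos_le_divide_eq mult.commute)
      moreover have "\<eta> $ i \<le> (\<Sum>j\<in>UNIV. \<eta> $ j)" for i by (rule member_le_sum) auto
      ultimately have "real (\<eta> $ i) \<le> 2 * S / kappa c" for i
        by (meson of_nat_le_iff order_trans)
      then show "\<eta> \<in> cube (nat \<lfloor>2 * S / kappa c\<rfloor>)" by (simp add: cube_def le_nat_floor)
    qed
  qed simp
  have bound: "(\<Sum>\<eta>\<in>cube N. w \<eta>) \<le> 2 * (\<Sum>\<eta>\<in>A. w \<eta>)" for N
  proof -
    have "0 \<le> (\<Sum>\<eta>\<in>cube N. w \<eta> * drift \<eta>)"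
      using sum_cube_Down_le_Up[of N]
      by (simp add: drift_def w_def right_diff_distrib sum_subtractf sum_distrib_left del: rate.simps)
    also have "\<dots> \<le> (\<Sum>\<eta>\<in>cube N. S * (2 * (if \<eta> \<in> A then w \<eta> else 0) - w \<eta>))"
    proof (rule sum_mono)
      fix \<eta> :: "nat ^ 'd"
      have nn: "0 \<le> kappa c * real (\<Sum>j\<in>UNIV. \<eta> $ j)"
        using kappa by (intro mult_nonneg_nonneg of_nat_0_le_iff) simp
      have "w \<eta> * drift \<eta> \<le> w \<eta> * (S - kappa c * real (\<Sum>j\<in>UNIV. \<eta> $ j))"
        using drift_le[of \<eta>] w[of \<eta>] by (intro mult_left_mono) (auto simp: S_def)
      also have "w \<eta> * (S - kappa c * real (\<Sum>j\<in>UNIV. \<eta> $ j)) \<le> w \<eta> * (if \<eta> \<in> A then S else - S)"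
        using w[of \<eta>] nn by (intro mult_left_mono) (auto simp: A_def simp del: of_nat_sum)
      finally show "w \<eta> * drift \<eta> \<le> S * (2 * (if \<eta> \<in> A then w \<eta> else 0) - w \<eta>)"
        by (auto simp: algebra_simps split: if_splits)
    qed
    also have "\<dots> = S * (2 * (\<Sum>\<eta>\<in>cube N \<inter> A. w \<eta>) - (\<Sum>\<eta>\<in>cube N. w \<eta>))"
      by (simp add: sum_distrib_left[symmetric] sum_subtractf sum.inter_restrict)
    finally have "(\<Sum>\<eta>\<in>cube N. w \<eta>) \<le> 2 * (\<Sum>\<eta>\<in>cube N \<inter> A. w \<eta>)"
      using S by (simp add: zero_le_mult_iff)
    also have "(\<Sum>\<eta>\<in>cube N \<inter> A. w \<eta>) \<le> (\<Sum>\<eta>\<in>A. w \<eta>)"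
      using \<open>finite A\<close> w by (intro sum_mono2) (auto simp: less_imp_le)
    finally show ?thesis by simp
  qed
  show ?thesis
  proof (rule nonneg_bdd_above_summable_on)
    show "bdd_above (sum (weight Vp Vm) ` {F. F \<subseteq> UNIV \<and> finite F})"
    proof (rule bdd_aboveI2)
      fix F :: "(nat ^ 'd) set" assume "F \<in> {F. F \<subseteq> UNIV \<and> finite F}"
      then obtain N where "F \<subseteq> cube N" by (auto elim: finite_subset_cube)
      then have "sum w F \<le> sum w (cube N)" using w by (intro sum_mono2) (auto simp: less_imp_le)
      with bound[of N] show "sum (weight Vp Vm) F \<le> 2 * (\<Sum>\<eta>\<in>A. w \<eta>)" by (simp add: w_def)
    qed
  qed (simp add: less_imp_le)
qed

end

lemma irreducible_rate: "irreducible_rates (rate Vp Vm)"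
proof -
  define R where "R = {(\<zeta>, act \<sigma> \<zeta>) | \<zeta> \<sigma>. rate Vp Vm \<zeta> \<sigma> > 0}"
  have up: "(\<eta>, act (Up i) \<eta>) \<in> R" for \<eta> i
    unfolding R_def using rate_pos_iff[of Vp Vm \<eta> "Up i"] by auto
  have down: "(act (Up i) \<eta>, \<eta>) \<in> R" for \<eta> i
    unfolding R_def using rate_pos_iff[of Vp Vm "act (Up i) \<eta>" "Down i"] act_Down_Up[of i \<eta>]
    by (auto simp: act_Up_nth simp del: act_Down_Up rate.simps) metis
  have "(0, \<eta>) \<in> R\<^sup>* \<and> (\<eta>, 0) \<in> R\<^sup>*" for \<eta>
  proof (induction \<eta> rule: lattice_induct)
    case (Up \<eta> i)
    then show ?case
      using up[of \<eta> i] down[of i \<eta>] by (meson rtrancl.rtrancl_into_rtrancl converse_rtrancl_into_rtrancl)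
  qed simp
  then show ?thesis unfolding irreducible_rates_def R_def[symmetric] by (meson rtrancl_trans)
qed

section \<open>The Gibbs measure\<close>

locale gibbs_chain = nonneg_curvature Vp Vm for Vp Vm :: "nat ^ 'd::finite \<Rightarrow> real" +
  assumes normalizable: "weight Vp Vm summable_on UNIV"
begin

abbreviation m :: "nat ^ 'd \<Rightarrow> real" where
  "m \<equiv> gibbs Vp Vm"

lemma inverse_normalization_pos: "1 / (\<Sum>\<^sub>\<infinity>\<xi>\<in>UNIV. weight Vp Vm \<xi>) > 0"
proof -
  have "0 < (\<Sum>\<xi>\<in>{0}. weight Vp Vm \<xi>)" by simp
  also have "\<dots> \<le> (\<Sum>\<^sub>\<infinity>\<xi>\<in>UNIV. weight Vp Vm \<xi>)"
    by (rule finite_sum_le_infsum[OF normalizable]) (auto simp: less_imp_le)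
  finally show ?thesis by simp
qed

lemma gibbs_pos [simp]: "m \<eta> > 0"
  unfolding gibbs_def by (intro mult_pos_pos inverse_normalization_pos weight_pos)

lemma has_sum_gibbs: "(m has_sum 1) UNIV"
proof -
  have "((\<lambda>\<eta>. 1 / (\<Sum>\<^sub>\<infinity>\<xi>\<in>UNIV. weight Vp Vm \<xi>) * weight Vp Vm \<eta>) has_sum
      1 / (\<Sum>\<^sub>\<infinity>\<xi>\<in>UNIV. weight Vp Vm \<xi>) * (\<Sum>\<^sub>\<infinity>\<xi>\<in>UNIV. weight Vp Vm \<xi>)) UNIV"
    by (intro has_sum_cmult_right has_sum_infsum normalizable)
  then show ?thesis using inverse_normalization_pos by (simp add: gibbs_def[abs_def])
qed

lemma gibbs_detailed_balance: "m \<eta> * c \<eta> (Up i) = m (act (Up i) \<eta>) * c (act (Up i) \<eta>) (Down i)"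
  using weight_detailed_balance[of Vp Vm \<eta> i] by (simp add: gibbs_def del: rate.simps)

lemma sum_gibbs_cube_le: "(\<Sum>\<eta>\<in>cube N. m \<eta>) \<le> 1"
  by (rule finite_sum_le_has_sum[OF has_sum_gibbs]) (auto simp: less_imp_le)

text \<open>The upward rates are bounded by their total at 0. The downward rates may grow without
  bound, so their flow is controlled by the upward flow cube by cube.\<close>

lemma summable_flow: "(\<lambda>(\<eta>, \<sigma>). c \<eta> \<sigma> * m \<eta>) summable_on UNIV"
proof (rule nonneg_bdd_above_summable_on)
  define S where "S = (\<Sum>j\<in>UNIV. c 0 (Up j))"
  have "S \<ge> 0" unfolding S_def by (intro sum_nonneg rate_nonneg)
  define z where "z = 1 / (\<Sum>\<^sub>\<infinity>\<xi>\<in>UNIV. weight Vp Vm \<xi>)"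
  have m: "m \<eta> = z * weight Vp Vm \<eta>" for \<eta> by (simp add: gibbs_def z_def)
  have up: "(\<Sum>\<eta>\<in>cube N. \<Sum>i\<in>UNIV. c \<eta> (Up i) * m \<eta>) \<le> S" for N
  proof -
    have "(\<Sum>\<eta>\<in>cube N. \<Sum>i\<in>UNIV. c \<eta> (Up i) * m \<eta>) \<le> (\<Sum>\<eta>\<in>cube N. S * m \<eta>)"
      unfolding sum_distrib_right[symmetric] S_def
      by (intro sum_mono mult_right_mono sum_Up_rates_le less_imp_le gibbs_pos)
    also have "\<dots> = S * (\<Sum>\<eta>\<in>cube N. m \<eta>)" by (simp add: sum_distrib_left)
    also have "\<dots> \<le> S * 1" using sum_gibbs_cube_le \<open>S \<ge> 0\<close> by (intro mult_left_mono) auto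
    finally show ?thesis by simp
  qed
  have down: "(\<Sum>\<eta>\<in>cube N. \<Sum>i\<in>UNIV. c \<eta> (Down i) * m \<eta>) \<le> (\<Sum>\<eta>\<in>cube N. \<Sum>i\<in>UNIV. c \<eta> (Up i) * m \<eta>)" for N
  proof -
    have "z * (\<Sum>\<eta>\<in>cube N. \<Sum>i\<in>UNIV. weight Vp Vm \<eta> * c \<eta> (Down i))
        \<le> z * (\<Sum>\<eta>\<in>cube N. \<Sum>i\<in>UNIV. weight Vp Vm \<eta> * c \<eta> (Up i))"
      using inverse_normalization_pos
      by (intro mult_left_mono sum_cube_Down_le_Up) (simp add: z_def)
    then show ?thesis by (simp add: m sum_distrib_left mult_ac del: rate.simps)
  qed
  show "bdd_above (sum (\<lambda>(\<eta>, \<sigma>). c \<eta> \<sigma> * m \<eta>) ` {F. F \<subseteq> UNIV \<and> finite F})"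
  proof (rule bdd_aboveI2)
    fix F :: "((nat ^ 'd) \<times> 'd move) set" assume "F \<in> {F. F \<subseteq> UNIV \<and> finite F}"
    then have "finite (fst ` F)" by simp
    then obtain N where "fst ` F \<subseteq> cube N" by (rule finite_subset_cube)
    then have "F \<subseteq> cube N \<times> UNIV" by force
    then have "sum (\<lambda>(\<eta>, \<sigma>). c \<eta> \<sigma> * m \<eta>) F \<le> sum (\<lambda>(\<eta>, \<sigma>). c \<eta> \<sigma> * m \<eta>) (cube N \<times> UNIV)"
      by (intro sum_mono2) (auto simp: less_imp_le)
    also have "\<dots> = (\<Sum>\<eta>\<in>cube N. \<Sum>i\<in>UNIV. c \<eta> (Up i) * m \<eta>)
        + (\<Sum>\<eta>\<in>cube N. \<Sum>i\<in>UNIV. c \<eta> (Down i) * m \<eta>)"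
      by (simp add: sum.cartesian_product[symmetric] sum_UNIV_move sum.distrib del: rate.simps)
    also have "\<dots> \<le> S + S" using up[of N] down[of N] by linarith
    finally show "sum (\<lambda>(\<eta>, \<sigma>). c \<eta> \<sigma> * m \<eta>) F \<le> S + S" .
  qed
qed (auto simp: less_imp_le)

section \<open>Reversibility and invariance\<close>

lemma reverse_move:
  assumes "c \<eta> \<sigma> > 0"
  shows "act (inv_move \<sigma>) (act \<sigma> \<eta>) = \<eta>" "c (act \<sigma> \<eta>) (inv_move \<sigma>) > 0"
    "c (act \<sigma> \<eta>) (inv_move \<sigma>) * m (act \<sigma> \<eta>) = c \<eta> \<sigma> * m \<eta>"
  using assms gibbs_detailed_balance
  by (cases \<sigma>; simp add: rate_pos_iff act_Up_nth mult.commute del: rate.simps; metis act_Up_Down mult.commute)+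

text \<open>Reversal of jumps is an involution of the set of jumps of positive rate, and it
  preserves their flow. The restriction to this set is essential: \<open>Down i\<close> at an empty
  site is not undone by \<open>Up i\<close>.\<close>

lemma infsum_reverse:
  "(\<Sum>\<^sub>\<infinity>(\<eta>, \<sigma>)\<in>UNIV. F \<eta> \<sigma> * c \<eta> \<sigma> * m \<eta>)
    = (\<Sum>\<^sub>\<infinity>(\<eta>, \<sigma>)\<in>UNIV. F (act \<sigma> \<eta>) (inv_move \<sigma>) * c \<eta> \<sigma> * m \<eta>)"
proof -
  define S where "S = {(\<eta>, \<sigma>). c \<eta> \<sigma> > 0}"
  define T where "T = (\<lambda>(\<eta>, \<sigma> :: 'd move). (act \<sigma> \<eta>, inv_move \<sigma>))"
  have inv: "inv_move (inv_move \<sigma>) = \<sigma>" for \<sigma> :: "'d move" by (cases \<sigma>) auto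
  have zero: "c \<eta> \<sigma> = 0" if "(\<eta>, \<sigma>) \<notin> S" for \<eta> \<sigma>
    using that rate_nonneg[of Vp Vm \<eta> \<sigma>] by (auto simp: S_def simp del: rate_nonneg)
  have TT: "T (T x) = x" "T x \<in> S" if xS: "x \<in> S" for x
  proof -
    obtain \<eta> \<sigma> where x: "x = (\<eta>, \<sigma>)" "c \<eta> \<sigma> > 0" using xS unfolding S_def by blast
    show "T (T x) = x" "T x \<in> S" unfolding x(1) T_def S_def using reverse_move(1,2)[OF x(2)] inv
      by (simp_all del: rate.simps)
  qed
  then have bij: "bij_betw T S S"
    by (intro bij_betwI[where g = T]) auto
  have "(\<Sum>\<^sub>\<infinity>(\<eta>, \<sigma>)\<in>UNIV. F \<eta> \<sigma> * c \<eta> \<sigma> * m \<eta>) = infsum (\<lambda>(\<eta>, \<sigma>). F \<eta> \<sigma> * c \<eta> \<sigma> * m \<eta>) S"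
    by (rule infsum_cong_neutral) (auto simp: zero)
  also have "\<dots> = infsum (\<lambda>x. (\<lambda>(\<eta>, \<sigma>). F \<eta> \<sigma> * c \<eta> \<sigma> * m \<eta>) (T x)) S"
    by (rule infsum_reindex_bij_betw[OF bij, symmetric])
  also have "\<dots> = (\<Sum>\<^sub>\<infinity>(\<eta>, \<sigma>)\<in>UNIV. F (act \<sigma> \<eta>) (inv_move \<sigma>) * c \<eta> \<sigma> * m \<eta>)"
  proof (rule infsum_cong_neutral)
    fix x assume "x \<in> S \<inter> UNIV"
    then obtain \<eta> \<sigma> where x: "x = (\<eta>, \<sigma>)" "c \<eta> \<sigma> > 0" unfolding S_def by blast
    show "(\<lambda>(\<eta>, \<sigma>). F \<eta> \<sigma> * c \<eta> \<sigma> * m \<eta>) (T x)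
        = (\<lambda>(\<eta>, \<sigma>). F (act \<sigma> \<eta>) (inv_move \<sigma>) * c \<eta> \<sigma> * m \<eta>) x"
      unfolding x(1) T_def by (simp only: prod.case mult.assoc reverse_move(3)[OF x(2)])
  qed (auto simp: zero)
  finally show ?thesis .
qed

lemma Rev_gibbs: "Rev c m"
  unfolding Rev_def
proof (intro conjI allI impI)
  show "inv_move (inv_move \<sigma>) = \<sigma>" for \<sigma> :: "'d move" by (cases \<sigma>) auto
  show "act (inv_move \<sigma>) (act \<sigma> \<eta>) = \<eta>" if "m \<eta> * c \<eta> \<sigma> > 0" for \<eta> \<sigma>
    by (rule reverse_move(1)[OF zero_less_mult_pos[OF that gibbs_pos]])
qed (rule infsum_reverse)

text \<open>For bounded f the sums of f before and after the jump converge separately, and reversal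
  of jumps exchanges them. Their difference is the sum of the generator, collapsed over the finitely
  many moves.\<close>

lemma invariant_gibbs: "invariant_for c m"
  unfolding invariant_for_def
proof (intro allI impI)
  fix f :: "nat ^ 'd \<Rightarrow> real" assume "bounded (range f)"
  then obtain B where B: "\<bar>f \<eta>\<bar> \<le> B" for \<eta> unfolding bounded_iff by auto
  have summ: "(\<lambda>(\<eta>, \<sigma>). h \<eta> \<sigma> * c \<eta> \<sigma> * m \<eta>) summable_on UNIV" if h: "\<And>\<eta> \<sigma>. \<bar>h \<eta> \<sigma>\<bar> \<le> B"
    for h :: "nat ^ 'd \<Rightarrow> 'd move \<Rightarrow> real"
  proof (rule Infinite_Sum.abs_summable_summable, rule Infinite_Sum.abs_summable_on_comparison_test')
    show "(\<lambda>x. B * (\<lambda>(\<eta>, \<sigma>). c \<eta> \<sigma> * m \<eta>) x) summable_on UNIV"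
      by (rule summable_on_cmult_right[OF summable_flow])
    fix x :: "(nat ^ 'd) \<times> 'd move"
    obtain \<eta> \<sigma> where x: "x = (\<eta>, \<sigma>)" by (cases x)
    have "\<bar>h \<eta> \<sigma> * c \<eta> \<sigma> * m \<eta>\<bar> = \<bar>h \<eta> \<sigma>\<bar> * (c \<eta> \<sigma> * m \<eta>)"
      using rate_nonneg[of Vp Vm \<eta> \<sigma>] gibbs_pos[of \<eta>] by (simp only: abs_mult abs_of_nonneg abs_of_pos mult.assoc)
    also have "\<dots> \<le> B * (c \<eta> \<sigma> * m \<eta>)"
      by (intro mult_right_mono h mult_nonneg_nonneg rate_nonneg less_imp_le gibbs_pos)
    finally show "norm ((\<lambda>(\<eta>, \<sigma>). h \<eta> \<sigma> * c \<eta> \<sigma> * m \<eta>) x) \<le> B * (\<lambda>(\<eta>, \<sigma>). c \<eta> \<sigma> * m \<eta>) x"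
      by (simp only: x prod.case real_norm_def)
  qed
  let ?s = "\<Sum>\<^sub>\<infinity>(\<eta>, \<sigma>)\<in>UNIV. f \<eta> * c \<eta> \<sigma> * m \<eta>"
  have 1: "((\<lambda>(\<eta>, \<sigma>). f \<eta> * c \<eta> \<sigma> * m \<eta>) has_sum ?s) UNIV"
    by (intro has_sum_infsum summ B)
  have 2: "((\<lambda>(\<eta>, \<sigma>). f (act \<sigma> \<eta>) * c \<eta> \<sigma> * m \<eta>) has_sum ?s) UNIV"
    by (subst infsum_reverse) (intro has_sum_infsum summ B)
  have "((\<lambda>x. (\<lambda>(\<eta>, \<sigma>). f (act \<sigma> \<eta>) * c \<eta> \<sigma> * m \<eta>) x
      + - 1 * (\<lambda>(\<eta>, \<sigma>). f \<eta> * c \<eta> \<sigma> * m \<eta>) x) has_sum (?s + - 1 * ?s)) UNIV"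
    by (intro has_sum_add has_sum_cmult_right 1 2)
  moreover have "(\<lambda>x. (\<lambda>(\<eta>, \<sigma>). f (act \<sigma> \<eta>) * c \<eta> \<sigma> * m \<eta>) x
      + - 1 * (\<lambda>(\<eta>, \<sigma>). f \<eta> * c \<eta> \<sigma> * m \<eta>) x) = (\<lambda>(\<eta>, \<sigma>). c \<eta> \<sigma> * nabla \<sigma> f \<eta> * m \<eta>)"
    by (simp add: fun_eq_iff nabla_def algebra_simps del: rate.simps)
  ultimately have "((\<lambda>(\<eta>, \<sigma>). c \<eta> \<sigma> * nabla \<sigma> f \<eta> * m \<eta>) has_sum 0) (UNIV \<times> UNIV)"
    by (simp only: UNIV_Times_UNIV) simp
  then show "((\<lambda>\<eta>. generator c f \<eta> * m \<eta>) has_sum 0) UNIV"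
  proof (rule has_sum_SigmaD)
    fix \<eta>
    show "((\<lambda>\<sigma>. (\<lambda>(\<eta>, \<sigma>). c \<eta> \<sigma> * nabla \<sigma> f \<eta> * m \<eta>) (\<eta>, \<sigma>)) has_sum generator c f \<eta> * m \<eta>) UNIV"
      by (rule has_sum_finiteI) (simp_all add: generator_eq_sum_moves sum_distrib_right del: rate.simps)
  qed
qed

lemma Irr_gibbs: "Irr c m"
  unfolding Irr_def prob_mass_def
  using irreducible_rate has_sum_gibbs invariant_gibbs summable_flow by (auto simp: less_imp_le)

end

section \<open>Convex Sobolev inequalities\<close>

lemma infsum_ereal_le:
  fixes f :: "'a \<Rightarrow> real"
  assumes "\<And>x. f x \<ge> 0" and "\<And>F. finite F \<Longrightarrow> sum f F \<le> b"
  shows "(\<Sum>\<^sub>\<infinity>x\<in>UNIV. ereal (f x)) \<le> ereal b"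
proof -
  have "(\<Sum>\<^sub>\<infinity>x\<in>UNIV. ereal (f x)) = (SUP F\<in>{F. finite F \<and> F \<subseteq> UNIV}. (\<Sum>x\<in>F. ereal (f x)))"
    by (rule nonneg_infsum_complete) (use assms(1) in simp)
  also have "\<dots> \<le> ereal b" by (rule SUP_least) (use assms(2) in simp)
  finally show ?thesis .
qed

lemma sum_le_infsum_ereal:
  fixes f :: "'a \<Rightarrow> real"
  assumes "\<And>x. f x \<ge> 0" and "finite F"
  shows "ereal (sum f F) \<le> (\<Sum>\<^sub>\<infinity>x\<in>UNIV. ereal (f x))"
proof -
  have "(\<Sum>\<^sub>\<infinity>x\<in>UNIV. ereal (f x)) = (SUP F\<in>{F. finite F \<and> F \<subseteq> UNIV}. (\<Sum>x\<in>F. ereal (f x)))"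
    by (rule nonneg_infsum_complete) (use assms(1) in simp)
  moreover have "(\<Sum>x\<in>F. ereal (f x)) \<le> (SUP F\<in>{F. finite F \<and> F \<subseteq> UNIV}. (\<Sum>x\<in>F. ereal (f x)))"
    by (rule SUP_upper) (use assms(2) in simp)
  ultimately show ?thesis by simp
qed

context gibbs_chain
begin

text \<open>Everything is required on the open half-line, where f takes its values; there
  \<open>phi_1\<close> and \<open>phi_alpha\<close> are controlled by their derivatives.\<close>

theorem convex_sobolev_gibbs:
  assumes \<phi>: "\<And>a. a > 0 \<Longrightarrow> \<phi> a \<ge> 0" "convex_on {0<..} \<phi>" "\<And>a. a > 0 \<Longrightarrow> \<phi> differentiable at a"
    and \<Psi>: "edge_convex \<beta> (Phi \<phi>)" "\<beta> \<ge> 1"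
  shows "convex_sobolev c m \<phi> (\<beta> * kappa c)"
  unfolding convex_sobolev_def
proof (intro allI impI)
  fix f :: "nat ^ 'd \<Rightarrow> real"
  assume asm: "(\<forall>\<eta>. f \<eta> > 0) \<and> (\<lambda>\<eta>. f \<eta> * m \<eta>) summable_on UNIV"
  then have f: "\<And>\<eta>. f \<eta> > 0" by blast
  have Phi: "Phi \<phi> (f x) (f y) \<ge> 0" "Phi \<phi> (f x) (f y) = Phi \<phi> (f y) (f x)" for x y
  proof -
    have "\<forall>a>0. \<forall>b>0. Phi \<phi> a b \<ge> 0 \<and> Phi \<phi> a b = Phi \<phi> b a"
      using \<Psi>(1) unfolding edge_convex_def by (elim conjE)
    then show "Phi \<phi> (f x) (f y) \<ge> 0" "Phi \<phi> (f x) (f y) = Phi \<phi> (f y) (f x)"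
      using f[of x] f[of y] by blast+
  qed
  define G where "G = (\<lambda>(\<eta>, \<sigma>). c \<eta> \<sigma> * Phi \<phi> (f \<eta>) (f (act \<sigma> \<eta>)) * m \<eta>)"
  define R where "R = (\<Sum>\<^sub>\<infinity>x\<in>UNIV. ereal (G x))"
  have G: "G x \<ge> 0" for x
    unfolding G_def by (cases x) (simp only: prod.case, intro mult_nonneg_nonneg rate_nonneg Phi less_imp_le gibbs_pos)
  have R: "R \<ge> 0" unfolding R_def by (rule infsum_nonneg) (simp add: G)
  define s where "s = (\<Sum>\<^sub>\<infinity>\<eta>\<in>UNIV. f \<eta> * m \<eta>)"
  have "ereal (\<beta> * kappa c) * entropy_phi \<phi> m f \<le> ereal (1 / 2) * R"
  \<comment> \<open>For \<kappa> = 0 the left side is 0 even if the entropy is infinite, since 0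
    times \<infinity> is 0 in \<open>ereal\<close>; an infinite R makes the right side
    infinite.\<close>
  proof (cases "kappa c = 0 \<or> R = \<infinity>")
    case True
    have "0 \<le> ereal (1 / 2) * R" using R by simp
    then show ?thesis using True by (auto simp: zero_ereal_def[symmetric])
  next
    case False
    then have kappa: "kappa c > 0" using kappa_nonneg by simp
    obtain r where r: "R = ereal r" using False R by (cases R) auto
    define b where "b = \<beta> * kappa c"
    have b: "b > 0" using kappa \<Psi>(2) by (simp add: b_def)
    have s_pos: "s > 0"
    proof -
      have "0 < (\<Sum>\<eta>\<in>{0}. f \<eta> * m \<eta>)" using f by simp
      also have "\<dots> \<le> s" unfolding s_def
        using asm f by (intro finite_sum_le_infsum) (auto simp: less_imp_le)
      finally show ?thesis .
    qed
    have phi_nn: "\<phi> (f \<eta>) * m \<eta> \<ge> 0" for \<eta>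
      using \<phi>(1)[OF f] gibbs_pos[of \<eta>] by (simp add: less_imp_le)
    define B where "B = (\<lambda>N. \<Sum>\<eta>\<in>cube N. m \<eta>)"
    define S where "S = (\<lambda>N. \<Sum>\<eta>\<in>cube N. m \<eta> * f \<eta>)"
    \<comment> \<open>The cube carries only the mass \<open>B N\<close> of the measure, so the mean
      of f over it is \<open>S N / B N\<close> and the value of \<phi> there is multiplied by
      \<open>B N\<close>.\<close>
    have cube_bound: "(\<Sum>\<eta>\<in>cube N. \<phi> (f \<eta>) * m \<eta>) \<le> r / (2 * b) + B N * \<phi> (S N / B N)" for N
    proof -
      interpret cube_chain "truncate N c" m N "kappa c"
        using cube_chain_truncate[OF inverse_normalization_pos kappa, of N]
        by (simp only: gibbs_def[abs_def])
      \<comment> \<open>The sum over all moves meets each edge twice, once from either end; detailed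
        balance and the symmetry of \<open>Phi\<close> make the two contributions equal.\<close>
      have "2 * energy (\<lambda>x y. Phi \<phi> (f x) (f y))
          = (\<Sum>\<eta>\<in>cube N. \<Sum>\<sigma>\<in>UNIV. truncate N c \<eta> \<sigma> * Phi \<phi> (f \<eta>) (f (act \<sigma> \<eta>)) * m \<eta>)"
      proof -
        have "(\<Sum>\<eta>\<in>cube N. \<Sum>i\<in>UNIV. truncate N c \<eta> (Down i) * Phi \<phi> (f \<eta>) (f (act (Down i) \<eta>)) * m \<eta>)
            = (\<Sum>i\<in>UNIV. \<Sum>\<eta>\<in>cube N. m \<eta> * truncate N c \<eta> (Down i) * Phi \<phi> (f \<eta>) (f (act (Down i) \<eta>)))"
          by (subst sum.swap) (simp only: mult_ac)
        also have "\<dots> = (\<Sum>i\<in>UNIV. \<Sum>\<eta>\<in>cube N. edge_weight \<eta> i * Phi \<phi> (f \<eta>) (f (act (Up i) \<eta>)))"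
          unfolding sum_Down_shift by (simp add: Phi(2))
        also have "\<dots> = energy (\<lambda>x y. Phi \<phi> (f x) (f y))"
          unfolding energy_def by (rule sum.swap)
        finally show ?thesis
          by (simp add: sum_UNIV_move sum.distrib energy_def edge_weight_def mult_ac)
      qed
      also have "\<dots> \<le> (\<Sum>\<eta>\<in>cube N. \<Sum>\<sigma>\<in>UNIV. G (\<eta>, \<sigma>))"
        using G by (intro sum_mono) (auto simp: truncate_def G_def)
      also have "\<dots> = sum G (cube N \<times> UNIV)"
        by (simp add: sum.cartesian_product)
      also have "\<dots> \<le> r"
        using sum_le_infsum_ereal[of G "cube N \<times> UNIV"] G r by (simp add: R_def)
      finally have "energy (\<lambda>x y. Phi \<phi> (f x) (f y)) \<le> r / 2" by simp
      moreover have "b * ((\<Sum>\<eta>\<in>cube N. m \<eta> * \<phi> (f \<eta>)) - B N * \<phi> (S N / B N))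
          \<le> energy (\<lambda>x y. Phi \<phi> (f x) (f y))"
        unfolding b_def B_def S_def by (rule entropy_le_energy[OF \<phi>(2,3) \<Psi> f])
      ultimately have "b * ((\<Sum>\<eta>\<in>cube N. m \<eta> * \<phi> (f \<eta>)) - B N * \<phi> (S N / B N)) \<le> r / 2" by linarith
      then have "(\<Sum>\<eta>\<in>cube N. m \<eta> * \<phi> (f \<eta>)) - B N * \<phi> (S N / B N) \<le> r / (2 * b)"
        using b by (simp add: field_simps)
      then show ?thesis by (simp add: mult.commute)
    qed
    have "B \<longlonglongrightarrow> 1" unfolding B_def by (rule has_sum_imp_tendsto_cube[OF has_sum_gibbs])
    moreover have "S \<longlonglongrightarrow> s"
      using has_sum_imp_tendsto_cube[OF has_sum_infsum, of "\<lambda>\<eta>. f \<eta> * m \<eta>"] asm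
      by (simp add: S_def s_def mult.commute)
    moreover have "isCont \<phi> s"
      using \<phi>(3)[OF s_pos] by (simp add: differentiable_imp_continuous_within)
    ultimately have "(\<lambda>N. r / (2 * b) + B N * \<phi> (S N / B N)) \<longlonglongrightarrow> r / (2 * b) + 1 * \<phi> (s / 1)"
      by (intro tendsto_add tendsto_const tendsto_mult isCont_tendsto_compose[where g = \<phi>] tendsto_divide) auto
    then have lim: "(\<lambda>N. r / (2 * b) + B N * \<phi> (S N / B N)) \<longlonglongrightarrow> r / (2 * b) + \<phi> s" by simp
    have "(\<Sum>\<^sub>\<infinity>\<eta>\<in>UNIV. ereal (\<phi> (f \<eta>) * m \<eta>)) \<le> ereal (r / (2 * b) + \<phi> s)"
    proof (rule infsum_ereal_le[OF phi_nn])
      fix F :: "(nat ^ 'd) set" assume "finite F"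
      \<comment> \<open>The finite set stays fixed while N grows. Only the right side of
        \<open>cube_bound\<close> needs a limit, so finiteness of the entropy is a result here and
        not an assumption.\<close>
      then obtain M where M: "F \<subseteq> cube M" by (rule finite_subset_cube)
      show "(\<Sum>\<eta>\<in>F. \<phi> (f \<eta>) * m \<eta>) \<le> r / (2 * b) + \<phi> s"
      proof (rule tendsto_lowerbound[OF lim])
        show "\<forall>\<^sub>F N in sequentially. (\<Sum>\<eta>\<in>F. \<phi> (f \<eta>) * m \<eta>) \<le> r / (2 * b) + B N * \<phi> (S N / B N)"
          unfolding eventually_sequentially
        proof (intro exI[of _ M] allI impI)
          fix N assume "M \<le> N"
          then have "F \<subseteq> cube N" using M cube_mono by blast
          then have "(\<Sum>\<eta>\<in>F. \<phi> (f \<eta>) * m \<eta>) \<le> (\<Sum>\<eta>\<in>cube N. \<phi> (f \<eta>) * m \<eta>)"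
            by (intro sum_mono2 phi_nn) auto
          then show "(\<Sum>\<eta>\<in>F. \<phi> (f \<eta>) * m \<eta>) \<le> r / (2 * b) + B N * \<phi> (S N / B N)"
            using cube_bound[of N] by linarith
        qed
      qed simp
    qed
    then have "entropy_phi \<phi> m f \<le> ereal (r / (2 * b) + \<phi> s) - ereal (\<phi> s)"
      unfolding entropy_phi_def s_def[symmetric] by (rule ereal_minus_mono) simp
    also have "\<dots> = ereal (r / (2 * b))" by simp
    finally have "ereal b * entropy_phi \<phi> m f \<le> ereal b * ereal (r / (2 * b))"
      using b by (intro ereal_mult_left_mono) auto
    also have "ereal b * ereal (r / (2 * b)) = ereal (1 / 2) * R"
      using b by (simp add: r)
    finally show ?thesis by (simp only: b_def)
  qed
  then show "ereal (\<beta> * kappa c) * entropy_phi \<phi> m f \<le> ereal (1 / 2) *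
      (\<Sum>\<^sub>\<infinity>(\<eta>, \<sigma>)\<in>UNIV. ereal (c \<eta> \<sigma> * Phi \<phi> (f \<eta>) (f (act \<sigma> \<eta>)) * m \<eta>))"
    by (simp only: R_def G_def case_prod_unfold)
qed

end

theorem theorem3p1:
  fixes Vp Vm :: "nat ^ 'd::finite \<Rightarrow> real"
  assumes "\<And>\<eta> i. kappa_plus (rate Vp Vm) \<eta> i \<ge> 0"
    and "\<And>\<eta> i. kappa_minus (rate Vp Vm) \<eta> i \<ge> 0"
    and normalizable: "weight Vp Vm summable_on UNIV \<or> kappa (rate Vp Vm) > 0"
  shows "Irr (rate Vp Vm) (gibbs Vp Vm)
    \<and> Rev (rate Vp Vm) (gibbs Vp Vm)
    \<and> (\<forall>\<phi>. admissible \<phi> \<longrightarrow>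
         convex_sobolev (rate Vp Vm) (gibbs Vp Vm) \<phi> (kappa (rate Vp Vm)))
    \<and> modified_log_sobolev (rate Vp Vm) (gibbs Vp Vm) (kappa (rate Vp Vm))
    \<and> (\<forall>\<alpha>. 1 < \<alpha> \<and> \<alpha> \<le> 2 \<longrightarrow>
         beckner (rate Vp Vm) (gibbs Vp Vm) \<alpha> (\<alpha> * kappa (rate Vp Vm)))"
proof -
  interpret nonneg_curvature Vp Vm by standard (rule assms)+
  \<comment> \<open>A finite normalization constant is either given or comes from the Lyapunov bound
    when \<open>kappa\<close> is positive.\<close>
  interpret gibbs_chain Vp Vm
    by standard (use normalizable weight_summable in blast)
  have "convex_sobolev c m \<phi> (kappa c)" if "admissible \<phi>" for \<phi>
  proof -
    have "convex_on {0<..} \<phi>"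
      using that unfolding admissible_def by (auto intro: convex_on_subset)
    then show ?thesis
      using convex_sobolev_gibbs[OF _ _ _ edge_convex_Phi_admissible[OF that]] that
      by (simp add: admissible_def)
  qed
  moreover have "modified_log_sobolev c m (kappa c)"
  proof -
    have "phi_1 a \<ge> 0" if "a > 0" for a
      using convex_nonneg_of_critical[OF convex_on_phi_1 _ _ that] DERIV_phi_1[of 1]
      by (simp add: phi_1_def)
    then show ?thesis
      using convex_sobolev_gibbs[OF _ convex_on_phi_1 _ edge_convex_phi_1] DERIV_phi_1
      by (auto simp: modified_log_sobolev_def real_differentiable_def)
  qed
  moreover have "beckner c m \<alpha> (\<alpha> * kappa c)" if "1 < \<alpha>" "\<alpha> \<le> 2" for \<alpha>
  proof -
    have "phi_alpha \<alpha> a \<ge> 0" if "a > 0" for a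
      using convex_nonneg_of_critical[OF convex_on_phi_alpha _ _ that] DERIV_phi_alpha[of 1 \<alpha>] \<open>1 < \<alpha>\<close>
      by (simp add: phi_alpha_def)
    moreover have "phi_alpha \<alpha> differentiable at a" if "a > 0" for a
      using DERIV_phi_alpha[OF that] by (auto simp: real_differentiable_def)
    ultimately show ?thesis unfolding beckner_def
      using that by (intro convex_sobolev_gibbs convex_on_phi_alpha edge_convex_phi_alpha) auto
  qed
  ultimately show ?thesis using Irr_gibbs Rev_gibbs by blast
qed

end
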